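(* The barycentric subdivision of the boundary complex of a neighborly cubical polytope has a real-rooted $h$-polynomial.
   Context: A cubical polytope is a (convex) polytope all of whose facets are combinatorial cubes. A $d$-dimensional cubical polytope with $2^n$ vertices (some $n\ge d$) is called neighborly cubical if its $(\lfloor d/2\rfloor-1)$-skeleton is combinatorially equivalent to the $(\lfloor d/2\rfloor-1)$-skeleton of the $n$-dimensional cube. The boundary complex of a polytope is the polytopal complex of its proper faces (including $\emptyset$). The barycentric subdivision $\mathrm{sd}(\mathcal{C})$ of a polytopal complex $\mathcal{C}$ is the simplicial complex whose $k$-dimensional faces are the sets $\{F_0,\ldots,F_k\}$ of faces of $\mathcal{C}$ with $\emptyset\subsetneq F_0\subsetneq\cdots\subsetneq F_k$ (together with the empty face). For an $(m-1)$-dimensional complex $\mathcal{K}$, $f(\mathcal{K};x)=\sum_{k=-1}^{m-1}f_k(\mathcal{K})x^{k+1}$, where $f_k$ is the number of $k$-dimensional faces ($f_{-1}=1$), and $h(\mathcal{K};x)=(1-x)^m f(\mathcal{K};\frac{x}{1-x})$. A real polynomial is real-rooted if it is identically zero or has only real zeros. *)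

theory Defs
  imports
    "HOL-Analysis.Analysis"
    "HOL-Analysis.Finite_Function_Topology"
    "HOL-Computational_Algebra.Polynomial"
begin

text \<open>Complexes of polytopes are represented by their sets of faces, always including the empty
  face, and are compared through the inclusion order.\<close>

definition faces :: "'a::real_vector set \<Rightarrow> 'a set set" where
  "faces P = {F. F face_of P}"

definition boundary_complex :: "'a::real_vector set \<Rightarrow> 'a set set" where
  "boundary_complex P = {F. F face_of P \<and> F \<noteq> P}"

definition combinatorially_equivalent :: "'a set set \<Rightarrow> 'b set set \<Rightarrow> bool" where
  "combinatorially_equivalent \<C> \<D> \<longleftrightarrow>
     (\<exists>\<phi>. bij_betw \<phi> \<C> \<D> \<and> (\<forall>F\<in>\<C>. \<forall>G\<in>\<C>. F \<subseteq> G \<longleftrightarrow> \<phi> F \<subseteq> \<phi> G))"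

text \<open>The library's \<open>aff_dim\<close> is restricted to \<^class>\<open>euclidean_space\<close>.  The following version makes
  sense in every real vector space, so that it also applies to faces of the cubes below, which must
  be available in every dimension inside a single type.\<close>

definition affine_dim :: "'a::real_vector set \<Rightarrow> int" where
  "affine_dim S = (if S = {} then -1 else int (dim {x - y |x y. x \<in> S \<and> y \<in> S}))"

lemma affine_dim_eq_aff_dim: "affine_dim S = aff_dim S" for S :: "'a::euclidean_space set"
proof (cases "S = {}")
  case False
  then obtain a where a: "a \<in> S" by blast
  have "x - y \<in> span ((+) (- a) ` S)" if "x \<in> S" "y \<in> S" for x y
  proof -
    have "(- a + x) - (- a + y) \<in> span ((+) (- a) ` S)"
      using that by (intro span_diff span_base imageI)
    then show ?thesis by simp
  qed
  then have "{x - y |x y. x \<in> S \<and> y \<in> S} \<subseteq> span ((+) (- a) ` S)"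
    by blast
  moreover have "(+) (- a) ` S \<subseteq> span {x - y |x y. x \<in> S \<and> y \<in> S}"
  proof
    fix z assume "z \<in> (+) (- a) ` S"
    then obtain x where "x \<in> S" "z = x - a" by auto
    then show "z \<in> span {x - y |x y. x \<in> S \<and> y \<in> S}"
      using a by (intro span_base) blast
  qed
  ultimately have "span {x - y |x y. x \<in> S \<and> y \<in> S} = span ((+) (- a) ` S)"
    by (simp add: span_eq)
  then have "dim {x - y |x y. x \<in> S \<and> y \<in> S} = dim ((+) (- a) ` S)"
    by (rule span_eq_dim)
  moreover have "aff_dim S = int (dim ((+) (- a) ` S))"
    by (rule aff_dim_eq_dim[OF hull_inc[OF a]])
  ultimately show ?thesis
    using False by (simp add: affine_dim_def)
qed (simp add: affine_dim_def)

definition skeleton :: "int \<Rightarrow> 'a::real_vector set \<Rightarrow> 'a set set" where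
  "skeleton k P = {F. F face_of P \<and> affine_dim F \<le> k}"

text \<open>The cube \<open>[0,1]\<^sup>n\<close>, placed in the space of finitely supported real sequences.\<close>

definition std_cube :: "nat \<Rightarrow> (nat \<Rightarrow>\<^sub>0 real) set" where
  "std_cube n = {x. (\<forall>i<n. 0 \<le> Poly_Mapping.lookup x i \<and> Poly_Mapping.lookup x i \<le> 1) \<and>
                    (\<forall>i\<ge>n. Poly_Mapping.lookup x i = 0)}"

definition combinatorial_cube :: "'a::real_vector set \<Rightarrow> bool" where
  "combinatorial_cube Q \<longleftrightarrow>
     polytope Q \<and> (\<exists>k. combinatorially_equivalent (faces Q) (faces (std_cube k)))"

definition cubical_polytope :: "'a::euclidean_space set \<Rightarrow> bool" where
  "cubical_polytope P \<longleftrightarrow> polytope P \<and> (\<forall>F. F facet_of P \<longrightarrow> combinatorial_cube F)"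

definition neighborly_cubical_polytope :: "'a::euclidean_space set \<Rightarrow> bool" where
  "neighborly_cubical_polytope P \<longleftrightarrow>
     cubical_polytope P \<and>
     (\<exists>d n. aff_dim P = int d \<and> d \<le> n \<and>
            card {v. v extreme_point_of P} = 2 ^ n \<and>
            combinatorially_equivalent
              (skeleton (int (d div 2) - 1) P) (skeleton (int (d div 2) - 1) (std_cube n)))"

text \<open>An abstract simplicial complex is represented by its set of faces, each face being a finite
  set of vertices; a face of dimension \<open>k\<close> has \<open>k + 1\<close> elements.\<close>

definition barycentric_subdivision :: "'a set set \<Rightarrow> 'a set set set" where
  "barycentric_subdivision \<C> = {\<sigma>. finite \<sigma> \<and> subset.chain (\<C> - {{}}) \<sigma>}"

text \<open>One more than the dimension; this is the number \<open>m\<close> for an \<open>(m - 1)\<close>-dimensional complex.\<close>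

definition complex_rank :: "'v set set \<Rightarrow> nat" where
  "complex_rank K = Max (card ` K)"

text \<open>\<open>num_faces K i\<close> is \<open>f\<^bsub>i-1\<^esub>(K)\<close>, the index being shifted by one to start at \<open>0\<close>.\<close>

definition num_faces :: "'v set set \<Rightarrow> nat \<Rightarrow> nat" where
  "num_faces K i = card {\<sigma>\<in>K. card \<sigma> = i}"

definition f_polynomial :: "'v set set \<Rightarrow> real poly" where
  "f_polynomial K = (\<Sum>i\<le>complex_rank K. monom (of_nat (num_faces K i)) i)"

text \<open>The polynomial \<open>(1 - x)\<^sup>m f(x / (1 - x))\<close> with denominators cleared; see
  \<open>poly_h_polynomial\<close>.\<close>

definition h_polynomial :: "'v set set \<Rightarrow> real poly" where
  "h_polynomial K =
     (\<Sum>i\<le>complex_rank K.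
        smult (of_nat (num_faces K i)) ([:0, 1:] ^ i * [:1, -1:] ^ (complex_rank K - i)))"

lemma poly_h_polynomial:
  assumes "x \<noteq> 1"
  shows "poly (h_polynomial K) x =
           (1 - x) ^ complex_rank K * poly (f_polynomial K) (x / (1 - x))"
proof -
  let ?m = "complex_rank K"
  have "x ^ i * (1 - x) ^ (?m - i) = (1 - x) ^ ?m * (x / (1 - x)) ^ i" if "i \<le> ?m" for i
  proof -
    have eq: "(1 - x) ^ ?m = (1 - x) ^ (?m - i) * (1 - x) ^ i"
      using that by (metis power_add le_add_diff_inverse2)
    show ?thesis
      unfolding eq using assms by (simp add: field_simps)
  qed
  then have "of_nat (num_faces K i) * (x ^ i * (1 - x) ^ (?m - i)) =
      (1 - x) ^ ?m * (of_nat (num_faces K i) * (x / (1 - x)) ^ i)" if "i \<le> ?m" for i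
    using that by (metis mult.left_commute)
  then have "(\<Sum>i\<le>?m. of_nat (num_faces K i) * (x ^ i * (1 - x) ^ (?m - i))) =
             (\<Sum>i\<le>?m. (1 - x) ^ ?m * (of_nat (num_faces K i) * (x / (1 - x)) ^ i))"
    by (intro sum.cong refl) (metis atMost_iff)
  moreover have "poly (h_polynomial K) x =
      (\<Sum>i\<le>?m. of_nat (num_faces K i) * (x ^ i * (1 - x) ^ (?m - i)))"
    by (simp add: h_polynomial_def poly_sum)
  moreover have "poly (f_polynomial K) (x / (1 - x)) =
      (\<Sum>i\<le>?m. of_nat (num_faces K i) * (x / (1 - x)) ^ i)"
    by (simp only: f_polynomial_def poly_sum poly_monom)
  ultimately show ?thesis
    by (simp only: sum_distrib_left)
qed

definition real_rooted :: "real poly \<Rightarrow> bool" where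
  "real_rooted p \<longleftrightarrow> p = 0 \<or> (\<forall>z::complex. poly (map_poly of_real p) z = 0 \<longrightarrow> z \<in> \<real>)"

end

theory Submission
  imports Defs
begin

text \<open>
  Write \<open>b\<^sub>k(y)\<close> for the polynomial counting chains of nonempty proper faces of the \<open>k\<close>-cube by their
  number of elements, and \<open>M\<close> for the linear functional on polynomials with \<open>M(t\<^sup>k) = b\<^sub>k(y)\<close>. For a
  cubical polytope \<open>P\<close> of dimension \<open>n + 1\<close>, up to a power of \<open>1 - x\<close> the h-polynomial is
  \<open>1 + y M(F)\<close>, where \<open>y = x / (1 - x)\<close> and \<open>F\<close> counts the nonempty proper faces of \<open>P\<close> by dimension.

  Ordering the facets by a generic line shelling and assigning each face to the first facet
  containing it splits \<open>F\<close> into \<open>(t + 2)\<^sup>n\<close> (first facet), \<open>t\<^sup>n\<close> (last facet) and products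
  \<open>(t + 1)\<^sup>a t\<^sup>b (t + 2)\<^sup>c\<close> with \<open>a > 0\<close>: a pair of opposite facets of the new cube contributes \<open>t + 2\<close>, \<open>t + 1\<close>
  or \<open>t\<close> according to how many of the two lie in earlier facets. Since \<open>2 (t + 1) = t + (t + 2)\<close>, the
  case \<open>a = 1\<close> suffices. The polynomials in \<open>x\<close> obtained from \<open>(t + 2)\<^sup>n\<close>,
  \<open>(t + 1) t\<^sup>i (t + 2)\<^sup>n\<^sup>-\<^sup>1\<^sup>-\<^sup>i\<close> (\<open>i < n\<close>) and \<open>t\<^sup>n\<close> form an interlacing sequence, which is checked through
  their arguments at a point of the upper half-plane; hence the h-polynomial, a nonnegative
  combination of them, has no zero there.

  A product with \<open>a = 0\<close> is excluded for the other facets by applying the bijectivity of the outmap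
  of a unique sink orientation to a linear functional separating the new cube from the point
  where the shelling line meets its affine hull.
\<close>

section \<open>Interlacing at a point of the upper half-plane\<close>

text \<open>Interlacing is expressed pointwise: at \<open>z\<close> in the upper half-plane the arguments of the values
  \<open>f i\<close> increase with \<open>i\<close> and stay below that of \<open>z * f 0\<close>.\<close>

lemma interlacing_step:
  fixes f :: "nat \<Rightarrow> complex" and z :: complex
  assumes z: "Im z > 0"
    and up: "\<And>i j. i \<le> j \<Longrightarrow> j < N \<Longrightarrow> Im (f j * cnj (f i)) \<ge> 0"
    and down: "\<And>i j. i \<le> j \<Longrightarrow> j < N \<Longrightarrow> Im (z * f i * cnj (f j)) \<ge> 0"
    and ik: "i \<le> k" "k \<le> N"
  defines "g \<equiv> \<lambda>i. z * sum f {..<i} + sum f {i..<N}"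
  shows "Im (g k * cnj (g i)) \<ge> 0" "Im (z * g i * cnj (g k)) \<ge> 0"
proof -
  \<comment> \<open>The index range is cut at \<open>i\<close> and \<open>k\<close>. From
    \<open>g i\<close> to \<open>g k\<close> only the coefficient of the middle block
    \<open>m\<close> changes, from 1 to \<open>z\<close>; both products therefore expand into sign
    conditions on pairs of blocks and a nonnegative multiple of a squared modulus.\<close>
  define p where "p = sum f {..<i}"
  define m where "m = sum f {i..<k}"
  define s where "s = sum f {k..<N}"
  have gi: "g i = z * p + (m + s)"
    unfolding g_def p_def m_def s_def using ik by (simp add: sum.atLeastLessThan_concat)
  have gk: "g k = z * (p + m) + s"
    unfolding g_def p_def m_def s_def
    using ik sum.atLeastLessThan_concat[of 0 i k f] by (simp add: lessThan_atLeast0)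
  have up_sum: "Im (sum f B * cnj (sum f A)) \<ge> 0"
    if "\<And>a b. a \<in> A \<Longrightarrow> b \<in> B \<Longrightarrow> a \<le> b \<and> b < N" for A B
    unfolding cnj_sum sum_product Im_sum using that by (intro sum_nonneg up) auto
  have down_sum: "Im (z * sum f A * cnj (sum f B)) \<ge> 0"
    if "\<And>a b. a \<in> A \<Longrightarrow> b \<in> B \<Longrightarrow> a \<le> b \<and> b < N" for A B
  proof -
    have "z * sum f A * cnj (sum f B) = (\<Sum>a\<in>A. \<Sum>b\<in>B. z * f a * cnj (f b))"
      by (simp only: cnj_sum sum_product mult.assoc) (simp only: sum_distrib_left)
    also have "Im \<dots> \<ge> 0"
      unfolding Im_sum using that by (intro sum_nonneg down) auto
    finally show ?thesis .
  qed
  have mp: "Im (m * cnj p) \<ge> 0" "Im (z * p * cnj m) \<ge> 0"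
    unfolding p_def m_def using ik by - (rule up_sum down_sum; simp)+
  have sm: "Im (s * cnj m) \<ge> 0" "Im (z * m * cnj s) \<ge> 0"
    unfolding s_def m_def using ik by - (rule up_sum down_sum; simp)+
  have sp: "Im (s * cnj p) \<ge> 0" "Im (z * p * cnj s) \<ge> 0"
    unfolding s_def p_def using ik by - (rule up_sum down_sum; simp)+
  have "Im (g k * cnj (g i)) = (cmod z)\<^sup>2 * Im (m * cnj p) + Im (z * p * cnj m)
      + Im z * (cmod m)\<^sup>2 + Im (z * m * cnj s) + Im (s * cnj m)
      + (Im (z * p * cnj s) + Im (s * cnj (z * p)))"
    unfolding gi gk cmod_power2 by (simp add: algebra_simps power2_eq_square)
  moreover have "Im (z * p * cnj s) + Im (s * cnj (z * p)) = 0"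
    by (simp add: algebra_simps)
  ultimately show "Im (g k * cnj (g i)) \<ge> 0"
    using mp sm z by simp
  have "Im (z * g i * cnj (g k)) = (cmod z)\<^sup>2 * Im (z * p * cnj m) + (cmod z)\<^sup>2 * Im (m * cnj p)
      + Im (z * m * cnj s) + (cmod z)\<^sup>2 * Im (s * cnj m) + Im z * (cmod (z * p + s))\<^sup>2"
    unfolding gi gk cmod_power2 by (simp add: algebra_simps power2_eq_square)
  then show "Im (z * g i * cnj (g k)) \<ge> 0"
    using mp sm z by simp
qed

text \<open>Chains in the boundary of the \<open>n\<close>-cube, weighted by \<open>y\<close> to the number of elements, are sorted by
  their top element; the cube has \<open>(n choose i) * 2 ^ (n - i)\<close> faces of dimension \<open>i\<close>.\<close>

fun cube_chains :: "complex \<Rightarrow> nat \<Rightarrow> complex" where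
  "cube_chains y n = 1 + y * (\<Sum>i<n. of_nat (n choose i) * 2 ^ (n - i) * cube_chains y i)"

declare cube_chains.simps [simp del]

lemma cube_chains_0 [simp]: "cube_chains y 0 = 1"
  by (subst cube_chains.simps) simp

text \<open>This is the functional \<open>M\<close> of the introduction, with the chain polynomials
  of cube boundaries evaluated at the fixed number \<open>y\<close>.\<close>

definition chain_functional :: "complex \<Rightarrow> complex poly \<Rightarrow> complex" where
  "chain_functional y p = (\<Sum>k\<le>degree p. coeff p k * cube_chains y k)"

lemma chain_functional_bound:
  assumes "degree p \<le> n"
  shows "chain_functional y p = (\<Sum>k\<le>n. coeff p k * cube_chains y k)"
  unfolding chain_functional_def using assms
  by (intro sum.mono_neutral_left) (auto simp: coeff_eq_0)

lemma chain_functional_add: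
  "chain_functional y (p + q) = chain_functional y p + chain_functional y q"
  by (simp add: chain_functional_bound[of _ "max (degree p) (degree q)"] degree_add_le
      sum.distrib algebra_simps)

lemma chain_functional_smult: "chain_functional y (smult c p) = c * chain_functional y p"
  by (simp add: chain_functional_bound[of _ "degree p"] degree_smult_le sum_distrib_left mult.assoc)

lemma chain_functional_diff:
  "chain_functional y (p - q) = chain_functional y p - chain_functional y q"
  using chain_functional_add[of y "p - q" q] by simp

lemma chain_functional_sum: "chain_functional y (sum f A) = (\<Sum>x\<in>A. chain_functional y (f x))"
  by (induction A rule: infinite_finite_induct)
     (simp_all add: chain_functional_add, simp_all add: chain_functional_def)

lemma chain_functional_monom: "chain_functional y (monom c n) = c * cube_chains y n"
proof -
  have "(\<Sum>k\<le>n. coeff (monom c n) k * cube_chains y k) = (\<Sum>k\<le>n. if n = k then c * cube_chains y k else 0)"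
    by (intro sum.cong) auto
  then show ?thesis
    by (subst chain_functional_bound[of _ n]) (auto simp: degree_monom_le)
qed

text \<open>\<open>(t + 2) ^ n\<close> counts the nonempty faces of the \<open>n\<close>-cube by
  dimension, the cube included: each coordinate is free or has one of two values.\<close>

lemma linear_power_eq_sum_monom:
  "[:2, 1:] ^ n = (\<Sum>k\<le>n. monom (of_nat (n choose k) * 2 ^ (n - k)) k :: complex poly)"
proof (rule poly_eqI)
  fix i
  have "coeff ([:2, 1:] ^ n :: complex poly) i = (if i \<le> n then of_nat (n choose i) * 2 ^ (n - i) else 0)"
    by (auto simp: coeff_linear_poly_power intro!: coeff_eq_0 simp: degree_linear_power)
  then show "coeff ([:2, 1:] ^ n) i = coeff (\<Sum>k\<le>n. monom (of_nat (n choose k) * 2 ^ (n - k)) k :: complex poly) i"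
    by (simp add: coeff_sum)
qed

lemma chain_functional_power2:
  "chain_functional y ([:2, 1:] ^ n)
     = (\<Sum>i<n. of_nat (n choose i) * 2 ^ (n - i) * cube_chains y i) + cube_chains y n"
  unfolding linear_power_eq_sum_monom chain_functional_sum chain_functional_monom
  by (simp add: lessThan_Suc_atMost[symmetric])

text \<open>\<open>(t + 2) ^ n - t ^ n\<close> counts the nonempty proper faces of the cube, so this
  is the recursion by top elements written through the functional.\<close>

lemma cube_chains_eq:
  "cube_chains y n = 1 + y * (chain_functional y ([:2, 1:] ^ n) - cube_chains y n)"
  unfolding chain_functional_power2 by (subst cube_chains.simps) simp

section \<open>The interlacing sequence attached to the cube\<close>

context
  fixes z :: complex
  assumes z: "Im z > 0"
begin

text \<open>The value at \<open>z\<close> of the h-polynomial of the subdivided boundary of the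
  \<open>n\<close>-cube.\<close>

definition "cube_h n = (1 - z) ^ n * cube_chains (z / (1 - z)) n"

text \<open>With \<open>y = z / (1 - z)\<close> this is \<open>(1 - z) ^ Suc n * y * M p\<close>:
  the contribution of the faces counted by \<open>p\<close> to the h-polynomial of a complex of rank
  \<open>n + 1\<close>.\<close>

definition "rel_h n p = (1 - z) ^ n * (z * chain_functional (z / (1 - z)) p)"

text \<open>The value of the middle product with exactly one factor \<open>t + 1\<close>.\<close>

definition "cube_step n i = rel_h n ([:1, 1:] * [:0, 1:] ^ i * [:2, 1:] ^ (n - 1 - i))"

definition "cube_seq n i = (if i = 0 then cube_h n else if i \<le> n then cube_step n (i - 1) else z * cube_h n)"

text \<open>The weights are differences of linear factors: 1 for \<open>t + 2\<close> and
  \<open>t + 1\<close> or for \<open>t + 1\<close> and \<open>t\<close> at the ends, 2 for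
  \<open>t + 2\<close> and \<open>t\<close> in between.\<close>

definition "cube_weight n i = (if i = 0 \<or> i = Suc n then 1 else 2 :: real)"

lemma z_neq_1: "1 - z \<noteq> 0"
  using z by auto

lemma rel_h_add: "rel_h n (p + q) = rel_h n p + rel_h n q"
  by (simp add: rel_h_def chain_functional_add algebra_simps)

lemma rel_h_diff: "rel_h n (p - q) = rel_h n p - rel_h n q"
  by (simp add: rel_h_def chain_functional_diff algebra_simps)

lemma rel_h_smult: "rel_h n (smult c p) = c * rel_h n p"
  by (simp add: rel_h_def chain_functional_smult)

lemma rel_h_Suc: "rel_h (Suc n) p = (1 - z) * rel_h n p"
  by (simp add: rel_h_def)

lemma rel_h_power: "rel_h n ([:0, 1:] ^ n) = z * cube_h n"
proof -
  have "[:0, 1:] ^ n = (monom 1 n :: complex poly)"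
    by (simp add: monom_altdef)
  then show ?thesis
    by (simp add: rel_h_def cube_h_def chain_functional_monom)
qed

text \<open>This is \<open>cube_chains_eq\<close> cleared of denominators; the subtracted power of
  \<open>1 - z\<close> comes from the empty chain.\<close>

lemma rel_h_power2: "rel_h n ([:2, 1:] ^ n) = cube_h n - (1 - z) ^ Suc n"
proof -
  let ?y = "z / (1 - z)"
  let ?M = "chain_functional ?y ([:2, 1:] ^ n)"
  have "z * (?M - cube_chains ?y n) = (1 - z) * (cube_chains ?y n - 1)"
    using cube_chains_eq[of ?y n] z_neq_1 by (simp add: field_simps)
  then have *: "z * ?M = cube_chains ?y n - (1 - z)"
    by (simp add: algebra_simps)
  show ?thesis
    unfolding rel_h_def cube_h_def * by (simp add: algebra_simps)
qed

text \<open>Consecutive products differ in a single linear factor, so their difference is a constant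
  times a product of degree one less; lowering the degree costs a factor
  \<open>1 - z\<close>.\<close>

lemma cube_seq_diff:
  assumes "i \<le> Suc n"
  shows "cube_seq (Suc n) i - cube_seq (Suc n) (Suc i) = (1 - z) * (cube_weight n i * cube_seq n i)"
proof -
  consider "i = 0" | "i = Suc n" | "0 < i" "i \<le> n"
    using assms by linarith
  then show ?thesis
  proof cases
    case 1
    have eq: "[:1, 1:] * [:2, 1:] ^ n = [:2, 1:] ^ Suc n - ([:2, 1:] ^ n :: complex poly)"
    proof -
      have "[:1, 1:] = [:2, 1:] - (1 :: complex poly)"
        by (simp add: one_pCons)
      then show ?thesis
        by (simp only: left_diff_distrib power_Suc mult_1)
    qed
    have "cube_seq (Suc n) 1 = cube_h (Suc n) - (1 - z) * cube_h n"
    proof -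
      have "cube_seq (Suc n) 1 = rel_h (Suc n) ([:2, 1:] ^ Suc n - [:2, 1:] ^ n)"
        unfolding cube_seq_def cube_step_def eq[symmetric] by simp
      \<comment> \<open>The two corrections coming from \<open>rel_h_power2\<close> cancel.\<close>
      also have "\<dots> = cube_h (Suc n) - (1 - z) ^ Suc (Suc n) - (1 - z) * (cube_h n - (1 - z) ^ Suc n)"
        by (simp only: rel_h_diff rel_h_power2 rel_h_Suc[of n "[:2, 1:] ^ n"])
      finally show ?thesis by (simp add: right_diff_distrib)
    qed
    then show ?thesis
      using 1 by (simp add: cube_seq_def cube_weight_def)
  next
    case 2
    have eq: "[:1, 1:] * [:0, 1:] ^ n = [:0, 1:] ^ Suc n + ([:0, 1:] ^ n :: complex poly)"
      by simp
    have "cube_seq (Suc n) (Suc n) = z * cube_h (Suc n) + (1 - z) * (z * cube_h n)"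
    proof -
      have "cube_seq (Suc n) (Suc n) = rel_h (Suc n) ([:0, 1:] ^ Suc n + [:0, 1:] ^ n)"
        unfolding cube_seq_def cube_step_def eq[symmetric] by simp
      also have "\<dots> = z * cube_h (Suc n) + (1 - z) * (z * cube_h n)"
        by (simp only: rel_h_add rel_h_power rel_h_Suc[of n "[:0, 1:] ^ n"])
      finally show ?thesis .
    qed
    then show ?thesis
      using 2 by (simp add: cube_seq_def cube_weight_def)
  next
    case 3
    then obtain j where j: "i = Suc j" "j < n"
      by (cases i) auto
    then have *: "n - j = Suc (n - 1 - j)" by simp
    have "[:1, 1:] * [:0, 1:] ^ j * [:2, 1:] ^ (n - j) - [:1, 1:] * [:0, 1:] ^ Suc j * [:2, 1:] ^ (n - 1 - j)
       = ([:1, 1:] * [:0, 1:] ^ j * [:2, 1:] ^ (n - 1 - j)) * ([:2, 1:] - [:0, 1:] :: complex poly)"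
      unfolding * by (simp only: power_Suc algebra_simps)
    also have "\<dots> = smult 2 ([:1, 1:] * [:0, 1:] ^ j * [:2, 1:] ^ (n - 1 - j))"
      by (simp add: mult.commute)
    finally have "cube_step (Suc n) j - cube_step (Suc n) (Suc j) = 2 * ((1 - z) * cube_step n j)"
      unfolding cube_step_def
      by (simp add: rel_h_diff[symmetric] rel_h_smult rel_h_Suc[symmetric]
          del: power_Suc mult_pCons_left)
    then show ?thesis
      using j by (simp add: cube_seq_def cube_weight_def)
  qed
qed

text \<open>Telescoping \<open>cube_seq_diff\<close> brings the recursion into the exact form
  treated by \<open>interlacing_step\<close>.\<close>

lemma cube_seq_Suc:
  assumes "i \<le> n + 2"
  shows "cube_seq (Suc n) i = z * (\<Sum>j<i. cube_weight n j * cube_seq n j)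
           + (\<Sum>j=i..<n+2. cube_weight n j * cube_seq n j)"
proof -
  define F where "F = (\<lambda>j. cube_weight n j * cube_seq n j)"
  have diff: "cube_seq (Suc n) 0 - cube_seq (Suc n) i = (1 - z) * sum F {..<i}" if "i \<le> n + 2" for i
    using that
  proof (induction i)
    case (Suc i)
    have "cube_seq (Suc n) 0 - cube_seq (Suc n) (Suc i)
       = (cube_seq (Suc n) 0 - cube_seq (Suc n) i) + (cube_seq (Suc n) i - cube_seq (Suc n) (Suc i))"
      by simp
    also have "\<dots> = (1 - z) * sum F {..<i} + (1 - z) * F i"
      using Suc.IH[OF Suc_leD[OF Suc.prems]] cube_seq_diff[of i n] Suc.prems
      by (simp add: F_def)
    finally show ?case by (simp add: algebra_simps)
  qed simp
  \<comment> \<open>The last entry is \<open>z\<close> times the first, so telescoping over the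
    whole range determines the first entry after division by \<open>1 - z\<close>.\<close>
  have "(1 - z) * cube_h (Suc n) = (1 - z) * sum F {..<n+2}"
    using diff[of "n + 2"] by (simp add: cube_seq_def algebra_simps)
  then have "cube_h (Suc n) = sum F {..<n+2}"
    using z_neq_1 by simp
  also have "\<dots> = sum F {..<i} + sum F {i..<n+2}"
    using sum.atLeastLessThan_concat[of 0 i "n+2" F] assms by (simp add: lessThan_atLeast0)
  finally have "cube_seq (Suc n) 0 = sum F {..<i} + sum F {i..<n+2}"
    by (simp add: cube_seq_def)
  then show ?thesis
    using diff[OF assms] by (simp add: F_def algebra_simps)
qed

text \<open>Induction on \<open>n\<close> from the sequence \<open>1, z\<close>. Nonnegative real
  weights preserve the sign conditions, and \<open>interlacing_step\<close> carries them to the next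
  level.\<close>

lemma cube_seq_interlacing:
  assumes "i \<le> j" "j < n + 2"
  shows "Im (cube_seq n j * cnj (cube_seq n i)) \<ge> 0 \<and> Im (z * cube_seq n i * cnj (cube_seq n j)) \<ge> 0"
  using assms
proof (induction n arbitrary: i j)
  case 0
  have [simp]: "cube_h 0 = 1"
    by (simp add: cube_h_def)
  have e: "cube_seq 0 0 = 1" "cube_seq 0 (Suc 0) = z"
    by (simp_all add: cube_seq_def)
  from 0 have "i = 0 \<and> j = 0 \<or> i = 0 \<and> j = 1 \<or> i = 1 \<and> j = 1" by linarith
  then show ?case
    using z by (elim disjE) (simp_all add: e)
next
  case (Suc n)
  define F where "F = (\<lambda>j. cube_weight n j * cube_seq n j)"
  have w: "cube_weight n j \<ge> 0" for j by (simp add: cube_weight_def)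
  have F: "Im (F j * cnj (F i)) \<ge> 0" "Im (z * F i * cnj (F j)) \<ge> 0" if "i \<le> j" "j < n + 2" for i j
  proof -
    have "F j * cnj (F i) = (cube_weight n j * cube_weight n i) *\<^sub>R (cube_seq n j * cnj (cube_seq n i))"
         "z * F i * cnj (F j) = (cube_weight n j * cube_weight n i) *\<^sub>R (z * cube_seq n i * cnj (cube_seq n j))"
      by (simp_all add: F_def scaleR_conv_of_real)
    then show "Im (F j * cnj (F i)) \<ge> 0" "Im (z * F i * cnj (F j)) \<ge> 0"
      using Suc.IH[OF that] w by (simp_all only: scaleR_complex.sel mult_nonneg_nonneg)
  qed
  have "cube_seq (Suc n) i = z * sum F {..<i} + sum F {i..<n+2}" if "i \<le> n + 2" for i
    using cube_seq_Suc[OF that] by (simp only: F_def)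
  moreover have "i \<le> n + 2" "j \<le> n + 2"
    using Suc.prems by simp_all
  moreover note interlacing_step[where f = F, OF z F \<open>i \<le> j\<close> \<open>j \<le> n + 2\<close>]
  ultimately show ?case
    by (simp only:)
qed

text \<open>In the sum for \<open>cube_h (Suc n)\<close> every term pairs nonnegatively with
  \<open>cube_h n\<close>, and the last one, \<open>z * cube_h n\<close>, does so strictly.\<close>

lemma cube_h_nonzero: "cube_h n \<noteq> 0"
proof (induction n)
  case 0
  then show ?case by (simp add: cube_h_def)
next
  case (Suc n)
  have "cube_h (Suc n) = (\<Sum>j<n+2. cube_weight n j * cube_seq n j)"
    using cube_seq_Suc[of 0 n] by (simp add: cube_seq_def lessThan_atLeast0)
  then have "Im (cube_h (Suc n) * cnj (cube_h n)) = (\<Sum>j<n+2. cube_weight n j * Im (cube_seq n j * cnj (cube_seq n 0)))"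
    by (simp add: sum_distrib_right cube_seq_def mult.assoc del: sum.lessThan_Suc)
  moreover have "(\<Sum>j\<in>{Suc n}. cube_weight n j * Im (cube_seq n j * cnj (cube_seq n 0)))
      \<le> (\<Sum>j<n+2. cube_weight n j * Im (cube_seq n j * cnj (cube_seq n 0)))"
    using cube_seq_interlacing[of 0 _ n] by (intro sum_mono2) (auto simp: cube_weight_def)
  moreover have "(\<Sum>j\<in>{Suc n}. cube_weight n j * Im (cube_seq n j * cnj (cube_seq n 0))) = Im z * (cmod (cube_h n))\<^sup>2"
    unfolding cmod_power2 by (simp add: cube_weight_def cube_seq_def algebra_simps power2_eq_square)
  moreover have "\<dots> > 0" using z Suc by simp
  ultimately have "Im (cube_h (Suc n) * cnj (cube_h n)) > 0" by linarith
  then show ?case by auto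
qed

text \<open>For \<open>a = 1\<close> the value is an entry of \<open>cube_seq\<close>; a further
  factor \<open>t + 1\<close> is the average of \<open>t\<close> and \<open>t + 2\<close>, which
  lowers \<open>a\<close>.\<close>

lemma rel_h_interlaced:
  assumes "0 < a" "a + b + c = n"
  shows "Im (rel_h n ([:1, 1:] ^ a * [:0, 1:] ^ b * [:2, 1:] ^ c) * cnj (cube_h n)) \<ge> 0"
  using assms
proof (induction a arbitrary: b c)
  case (Suc a)
  show ?case
  proof (cases "a = 0")
    case True
    then have "rel_h n ([:1, 1:] ^ Suc a * [:0, 1:] ^ b * [:2, 1:] ^ c) = cube_seq n (Suc b)"
      using Suc.prems by (auto simp: cube_seq_def cube_step_def)
    moreover have "cube_seq n 0 = cube_h n"
      by (simp add: cube_seq_def)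
    ultimately show ?thesis
      using cube_seq_interlacing[of 0 "Suc b" n] Suc.prems by simp
  next
    case False
    let ?p = "\<lambda>b c. [:1, 1:] ^ a * [:0, 1:] ^ b * [:2, 1:] ^ c :: complex poly"
    have "[:1, 1:] = smult (1/2) ([:0, 1:] + [:2, 1:] :: complex poly)"
      by simp
    then have "[:1, 1:] ^ Suc a * [:0, 1:] ^ b * [:2, 1:] ^ c = smult (1/2) ([:0, 1:] + [:2, 1:]) * ?p b c"
      by (simp only: power_Suc mult.assoc)
    also have "\<dots> = smult (1/2) (?p (Suc b) c + ?p b (Suc c))"
      unfolding mult_smult_left by (simp only: power_Suc distrib_left distrib_right mult_ac)
    finally have "rel_h n ([:1, 1:] ^ Suc a * [:0, 1:] ^ b * [:2, 1:] ^ c)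
        = (1/2) * (rel_h n (?p (Suc b) c) + rel_h n (?p b (Suc c)))"
      by (simp only: rel_h_smult rel_h_add)
    moreover have "Im (rel_h n (?p (Suc b) c) * cnj (cube_h n)) \<ge> 0"
        "Im (rel_h n (?p b (Suc c)) * cnj (cube_h n)) \<ge> 0"
      using Suc.prems False by (intro Suc.IH; simp)+
    moreover have "Im (1/2 * (u + v) * w) \<ge> 0" if "Im (u * w) \<ge> 0" "Im (v * w) \<ge> 0" for u v w
      using that by (simp add: algebra_simps)
    ultimately show ?thesis
      by (simp only:)
  qed
qed simp

end

text \<open>After multiplication by \<open>(1 - z) ^ Suc n\<close>, the product with the conjugate
  of \<open>cube_h z n\<close> has positive imaginary part: the last facet's term
  \<open>z * cube_h z n\<close> is strict, the others are nonnegative.\<close>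

theorem chain_functional_nonzero:
  fixes z :: complex and S :: "'i set"
  assumes z: "Im z > 0"
    and S: "\<And>j. j \<in> S \<Longrightarrow> 0 < a j \<and> a j + b j + c j = n"
    and p: "p = [:2, 1:] ^ n + [:0, 1:] ^ n + (\<Sum>j\<in>S. [:1, 1:] ^ a j * [:0, 1:] ^ b j * [:2, 1:] ^ c j)"
  shows "1 + z / (1 - z) * chain_functional (z / (1 - z)) p \<noteq> 0"
proof
  assume eq: "1 + z / (1 - z) * chain_functional (z / (1 - z)) p = 0"
  note nz = z_neq_1[OF z]
  let ?q = "\<lambda>j. [:1, 1:] ^ a j * [:0, 1:] ^ b j * [:2, 1:] ^ c j :: complex poly"
  have sum: "rel_h z n (sum f A) = (\<Sum>x\<in>A. rel_h z n (f x))" for f and A :: "'i set"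
    by (simp add: rel_h_def[OF z] chain_functional_sum sum_distrib_left)
  have "0 = (1 - z) ^ Suc n * (1 + z / (1 - z) * chain_functional (z / (1 - z)) p)"
    using eq by simp
  also have "\<dots> = (1 - z) ^ Suc n + rel_h z n p"
    using nz by (simp add: rel_h_def[OF z] field_simps)
  \<comment> \<open>The term \<open>(1 - z) ^ Suc n\<close> cancels the correction in
    \<open>rel_h_power2\<close>.\<close>
  also have "\<dots> = cube_h z n + z * cube_h z n + (\<Sum>j\<in>S. rel_h z n (?q j))"
    unfolding p by (simp add: rel_h_add[OF z] rel_h_power[OF z] rel_h_power2[OF z] sum)
  finally have "0 = Im ((cube_h z n + z * cube_h z n + (\<Sum>j\<in>S. rel_h z n (?q j))) * cnj (cube_h z n))"
    by simp
  also have "\<dots> = Im z * (cmod (cube_h z n))\<^sup>2 + (\<Sum>j\<in>S. Im (rel_h z n (?q j) * cnj (cube_h z n)))"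
    unfolding cmod_power2 by (simp add: distrib_right sum_distrib_right) (simp add: algebra_simps power2_eq_square)
  also have "\<dots> > 0"
    using z cube_h_nonzero[OF z, of n] S
    by (intro add_pos_nonneg sum_nonneg rel_h_interlaced[OF z]) (auto simp del: mult_pCons_left)
  finally show False by simp
qed

section \<open>Chains of faces\<close>

text \<open>For finite \<open>C\<close> this is the f-polynomial of the order complex of
  \<open>C\<close> at \<open>y\<close>, empty chain included.\<close>

definition chain_sum :: "complex \<Rightarrow> 'a set set \<Rightarrow> complex" where
  "chain_sum y C = (\<Sum>\<sigma>\<in>{\<sigma>. \<sigma> \<subseteq> C \<and> (\<forall>a\<in>\<sigma>. \<forall>b\<in>\<sigma>. a \<subseteq> b \<or> b \<subseteq> a)}. y ^ card \<sigma>)"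

lemma chain_has_top:
  assumes "finite \<sigma>" "\<sigma> \<noteq> {}" and chain: "\<And>a b. a \<in> \<sigma> \<Longrightarrow> b \<in> \<sigma> \<Longrightarrow> a \<subseteq> b \<or> b \<subseteq> a"
  obtains K where "K \<in> \<sigma>" "\<And>a. a \<in> \<sigma> \<Longrightarrow> a \<subseteq> K"
proof -
  obtain K where K: "K \<in> \<sigma>" "\<forall>a\<in>\<sigma>. K \<subseteq> a \<longrightarrow> K = a"
    using finite_has_maximal[OF assms(1,2)] by auto
  show ?thesis
  proof (rule that[OF K(1)])
    fix a assume "a \<in> \<sigma>"
    then show "a \<subseteq> K"
      using chain[OF _ K(1), of a] K(2) by auto
  qed
qed

text \<open>Nonempty chains are sorted by their top element \<open>K\<close>; removing
  \<open>K\<close> leaves a chain strictly below it. The recursion has the shape of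
  \<open>cube_chains\<close>.\<close>

lemma chain_sum_eq:
  assumes "finite C"
  shows "chain_sum y C = 1 + y * (\<Sum>K\<in>C. chain_sum y {K' \<in> C. K' \<subset> K})"
proof -
  define ch where "ch D = {\<sigma>. \<sigma> \<subseteq> D \<and> (\<forall>a\<in>\<sigma>. \<forall>b\<in>\<sigma>. a \<subseteq> b \<or> b \<subseteq> a)}" for D :: "'a set set"
  define below where "below K = {K' \<in> C. K' \<subset> K}" for K
  have fin: "finite (ch D)" if "D \<subseteq> C" for D
    by (rule finite_subset[of _ "Pow C"]) (use that assms in \<open>auto simp: ch_def\<close>)
  have finch: "finite \<sigma>" if "\<sigma> \<in> ch D" "D \<subseteq> C" for \<sigma> D
    using that assms by (auto simp: ch_def intro: finite_subset)
  have below: "below K \<subseteq> C" for K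
    by (auto simp: below_def)
  have "ch C = {{}} \<union> (\<Union>K\<in>C. insert K ` ch (below K))"
  proof (intro equalityI subsetI)
    fix \<sigma> assume \<sigma>: "\<sigma> \<in> ch C"
    show "\<sigma> \<in> {{}} \<union> (\<Union>K\<in>C. insert K ` ch (below K))"
    proof (cases "\<sigma> = {}")
      case False
      have "a \<subseteq> b \<or> b \<subseteq> a" if "a \<in> \<sigma>" "b \<in> \<sigma>" for a b
        using \<sigma> that by (simp add: ch_def)
      then obtain K where K: "K \<in> \<sigma>" "\<And>a. a \<in> \<sigma> \<Longrightarrow> a \<subseteq> K"
        using chain_has_top[OF finch[OF \<sigma> subset_refl] False] by metis
      then have "\<sigma> - {K} \<in> ch (below K)"
        using \<sigma> by (auto simp: ch_def below_def)
      moreover have "\<sigma> = insert K (\<sigma> - {K})" "K \<in> C"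
        using K \<sigma> by (auto simp: ch_def)
      ultimately show ?thesis by blast
    qed simp
  next
    fix \<sigma> assume "\<sigma> \<in> {{}} \<union> (\<Union>K\<in>C. insert K ` ch (below K))"
    then show "\<sigma> \<in> ch C"
    proof
      assume "\<sigma> \<in> (\<Union>K\<in>C. insert K ` ch (below K))"
      then obtain K \<tau> where "K \<in> C" "\<tau> \<in> ch (below K)" "\<sigma> = insert K \<tau>" by blast
      then show ?thesis
        by (auto simp: ch_def below_def)
    qed (simp add: ch_def)
  qed
  then have "ch C = insert {} (\<Union>K\<in>C. insert K ` ch (below K))"
    by simp
  moreover have "finite (\<Union>K\<in>C. insert K ` ch (below K))"
    using assms fin[OF below] by auto
  ultimately have "chain_sum y C = 1 + (\<Sum>\<sigma>\<in>(\<Union>K\<in>C. insert K ` ch (below K)). y ^ card \<sigma>)"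
    unfolding chain_sum_def ch_def[symmetric] by (simp only:) (subst sum.insert; auto)
  also have "(\<Sum>\<sigma>\<in>(\<Union>K\<in>C. insert K ` ch (below K)). y ^ card \<sigma>)
      = (\<Sum>K\<in>C. \<Sum>\<sigma>\<in>insert K ` ch (below K). y ^ card \<sigma>)"
  proof (rule sum.UNION_disjoint)
    \<comment> \<open>Two different tops of one chain would each lie strictly below the
      other.\<close>
    have "K = L" if "\<sigma> \<in> ch (below K)" "\<tau> \<in> ch (below L)" "insert K \<sigma> = insert L \<tau>" for K L \<sigma> \<tau>
    proof (rule ccontr)
      assume "K \<noteq> L"
      then have "K \<in> \<tau>" "L \<in> \<sigma>"
        using that(3) by auto
      then have "K \<subset> L" "L \<subset> K"
        using that(1,2) by (auto simp: ch_def below_def)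
      then show False by simp
    qed
    then show "\<forall>K\<in>C. \<forall>L\<in>C. K \<noteq> L \<longrightarrow> insert K ` ch (below K) \<inter> insert L ` ch (below L) = {}"
      by blast
  qed (use assms fin[OF below] in auto)
  also have "\<dots> = (\<Sum>K\<in>C. y * chain_sum y (below K))"
  proof (rule sum.cong[OF refl])
    fix K assume "K \<in> C"
    have notin: "K \<notin> \<sigma>" if "\<sigma> \<in> ch (below K)" for \<sigma>
      using that by (auto simp: ch_def below_def)
    have "inj_on (insert K) (ch (below K))"
      using notin by (auto simp: inj_on_def insert_ident)
    then have "(\<Sum>\<sigma>\<in>insert K ` ch (below K). y ^ card \<sigma>) = (\<Sum>\<sigma>\<in>ch (below K). y ^ card (insert K \<sigma>))"
      by (simp add: sum.reindex)
    also have "\<dots> = (\<Sum>\<sigma>\<in>ch (below K). y * y ^ card \<sigma>)"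
      using notin finch[OF _ below] by (intro sum.cong) auto
    finally show "(\<Sum>\<sigma>\<in>insert K ` ch (below K). y ^ card \<sigma>) = y * chain_sum y (below K)"
      by (simp add: chain_sum_def ch_def sum_distrib_left)
  qed
  finally show ?thesis
    by (simp add: below_def sum_distrib_left)
qed

text \<open>Grouping chains by size gives the defining sum of the h-polynomial, so its zeros other
  than 1 are governed by \<open>chain_sum\<close>.\<close>

lemma poly_h_polynomial_barycentric_subdivision:
  fixes C :: "'a set set" and z :: complex
  assumes fin: "finite C" and z: "z \<noteq> 1"
  defines "K \<equiv> barycentric_subdivision C"
  shows "poly (map_poly of_real (h_polynomial K)) z
           = (1 - z) ^ complex_rank K * chain_sum (z / (1 - z)) (C - {{}})"
proof -
  let ?m = "complex_rank K"
  have K: "K = {\<sigma>. \<sigma> \<subseteq> C - {{}} \<and> (\<forall>a\<in>\<sigma>. \<forall>b\<in>\<sigma>. a \<subseteq> b \<or> b \<subseteq> a)}"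
    using fin unfolding K_def barycentric_subdivision_def subset_chain_def
    by (auto dest: finite_subset)
  have finK: "finite K"
    by (rule finite_subset[of _ "Pow C"]) (use fin K in auto)
  have le: "card \<sigma> \<le> ?m" if "\<sigma> \<in> K" for \<sigma>
    unfolding complex_rank_def using finK that by simp
  have "poly (map_poly of_real (h_polynomial K)) z
      = (\<Sum>i\<le>?m. of_nat (num_faces K i) * (z ^ i * (1 - z) ^ (?m - i)))"
  proof -
    have hom: "poly (map_poly of_real (\<Sum>i\<in>A. smult (of_nat (a i)) ([:0, 1:] ^ i * [:1, -1:] ^ b i))) z
         = (\<Sum>i\<in>A. of_nat (a i) * (z ^ i * (1 - z) ^ b i))" for A and a b :: "nat \<Rightarrow> nat"
    proof -
      have add: "map_poly complex_of_real (p + q) = map_poly of_real p + map_poly of_real q" for p q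
        by (rule poly_eqI) (simp add: coeff_map_poly)
      have sum: "map_poly complex_of_real (sum f A) = (\<Sum>i\<in>A. map_poly of_real (f i))" for f and A :: "nat set"
        by (induction A rule: infinite_finite_induct) (simp_all add: add)
      have smult: "map_poly complex_of_real (smult c p) = smult (of_real c) (map_poly of_real p)" for c p
        by (rule poly_eqI) (simp add: coeff_map_poly)
      have mult: "map_poly complex_of_real (p * q) = map_poly of_real p * map_poly of_real q" for p q
        by (rule poly_eqI) (simp add: coeff_map_poly coeff_mult)
      have pow: "map_poly complex_of_real (p ^ k) = map_poly of_real p ^ k" for p k
        by (induction k) (simp_all add: mult)
      show ?thesis
        by (simp add: sum smult mult pow poly_sum map_poly_pCons)
    qed
    show ?thesis
      unfolding h_polynomial_def hom ..
  qed
  also have "\<dots> = (\<Sum>i\<le>?m. \<Sum>\<sigma>\<in>{\<sigma>\<in>K. card \<sigma> = i}. z ^ card \<sigma> * (1 - z) ^ (?m - card \<sigma>))"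
    by (intro sum.cong refl) (simp add: num_faces_def)
  also have "\<dots> = (\<Sum>\<sigma>\<in>K. z ^ card \<sigma> * (1 - z) ^ (?m - card \<sigma>))"
    using le finK by (intro sum.group) auto
  also have "\<dots> = (\<Sum>\<sigma>\<in>K. (1 - z) ^ ?m * (z / (1 - z)) ^ card \<sigma>)"
    using le z by (intro sum.cong) (auto simp: power_divide power_diff)
  finally show ?thesis
    by (simp add: chain_sum_def K sum_distrib_left)
qed

text \<open>Coordinates are chosen independently: an undefined one contributes \<open>t\<close>, a
  defined one contributes the number of its admissible values. For labels of cube faces the exponent
  is the dimension.\<close>

lemma sum_monom_maps:
  fixes G :: "nat \<Rightarrow> bool set"
  assumes "finite J"
  defines "N \<equiv> \<lambda>J. {m. dom m \<subseteq> J \<and> (\<forall>i e. m i = Some e \<longrightarrow> e \<in> G i)}"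
  shows "finite (N J) \<and> (\<Sum>m\<in>N J. monom (1 :: complex) (card J - card (dom m))) = (\<Prod>i\<in>J. [:of_nat (card (G i)), 1:])"
  using assms(1)
proof (induction J rule: finite_induct)
  case empty
  have "N {} = {Map.empty}"
    by (auto simp: N_def)
  then show ?case by simp
next
  case (insert x J)
  define U where "U e m = m(x \<mapsto> e)" for e :: bool and m :: "nat \<Rightarrow> bool option"
  let ?t = "\<lambda>J m. monom (1 :: complex) (card J - card (dom m))"
  have fin: "finite (N J)" and IH: "sum (?t J) (N J) = (\<Prod>i\<in>J. [:of_nat (card (G i)), 1:])"
    using insert by auto
  have dom: "dom m \<subseteq> J" "x \<notin> dom m" "m x = None" "finite (dom m)" "card (dom m) \<le> card J" if "m \<in> N J" for m
    using that insert.hyps by (auto simp: N_def card_mono dest: finite_subset)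
  have N': "N J = {m. \<forall>i e. m i = Some e \<longrightarrow> i \<in> J \<and> e \<in> G i}" for J
    by (auto simp: N_def dom_def)
  have eq: "N (insert x J) = N J \<union> (\<Union>e\<in>G x. U e ` N J)"
  proof (intro equalityI subsetI)
    fix m assume m: "m \<in> N (insert x J)"
    show "m \<in> N J \<union> (\<Union>e\<in>G x. U e ` N J)"
    proof (cases "m x")
      case None
      then show ?thesis using m by (auto simp: N_def)
    next
      case (Some e)
      then have "m(x := None) \<in> N J" "m = U e (m(x := None))" "e \<in> G x"
        using m by (auto simp: N_def U_def split: if_splits)
      then show ?thesis by blast
    qed
  qed (auto simp: N' U_def split: if_splits)
  have disj: "N J \<inter> (\<Union>e\<in>G x. U e ` N J) = {}"
    by (auto simp: U_def dest!: dom(3))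
  have finU: "finite (\<Union>e\<in>G x. U e ` N J)"
    using fin by auto
  have inj: "inj_on (U e) (N J)" for e
  proof (rule inj_onI)
    fix m m' assume "m \<in> N J" "m' \<in> N J" "U e m = U e m'"
    then show "m = m'"
      using dom(3) unfolding U_def by (metis fun_upd_triv fun_upd_upd)
  qed
  have "sum (?t (insert x J)) (\<Union>e\<in>G x. U e ` N J) = (\<Sum>e\<in>G x. sum (?t (insert x J)) (U e ` N J))"
  proof (rule sum.UNION_disjoint)
    show "\<forall>i\<in>G x. \<forall>j\<in>G x. i \<noteq> j \<longrightarrow> U i ` N J \<inter> U j ` N J = {}"
      unfolding U_def by (auto dest: fun_cong[of _ _ x])
  qed (use fin in auto)
  also have "\<dots> = (\<Sum>e\<in>G x. sum (?t J) (N J))"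
  proof (rule sum.cong[OF refl])
    fix e
    have "?t (insert x J) (U e m) = ?t J m" if "m \<in> N J" for m
      using dom[OF that] insert.hyps by (simp add: U_def)
    then show "sum (?t (insert x J)) (U e ` N J) = sum (?t J) (N J)"
      by (simp add: sum.reindex[OF inj])
  qed
  also have "\<dots> = [:of_nat (card (G x)):] * sum (?t J) (N J)"
    by (simp add: of_nat_poly)
  finally have 1: "sum (?t (insert x J)) (\<Union>e\<in>G x. U e ` N J) = [:of_nat (card (G x)):] * sum (?t J) (N J)" .
  have "?t (insert x J) m = [:0, 1:] * ?t J m" if "m \<in> N J" for m
    using dom[OF that] insert.hyps by (simp add: Suc_diff_le monom_Suc)
  then have 2: "sum (?t (insert x J)) (N J) = [:0, 1:] * sum (?t J) (N J)"
    by (simp only: sum_distrib_left cong: sum.cong)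
  have "sum (?t (insert x J)) (N (insert x J)) = [:of_nat (card (G x)), 1:] * sum (?t J) (N J)"
    unfolding eq sum.union_disjoint[OF fin finU disj] 1 2 distrib_right[symmetric] by simp
  then show ?case
    using insert.hyps eq fin finU by (simp add: IH del: mult_pCons_left)
qed

text \<open>Faces strictly below \<open>\<psi> m\<close> correspond to proper extensions of
  \<open>m\<close>, hence to nonempty partial maps on the free coordinates. They form the boundary
  of a smaller cube, and \<open>chain_sum_eq\<close> turns into
  \<open>cube_chains_eq\<close>.\<close>

lemma chain_sum_cube:
  fixes \<psi> :: "(nat \<Rightarrow> bool option) \<Rightarrow> 'a set"
  assumes fin: "finite I"
    and order: "\<And>m m'. dom m \<subseteq> I \<Longrightarrow> dom m' \<subseteq> I \<Longrightarrow> \<psi> m \<subseteq> \<psi> m' \<longleftrightarrow> m' \<subseteq>\<^sub>m m"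
    and "dom m \<subseteq> I"
  shows "chain_sum y {K \<in> \<psi> ` {m'. dom m' \<subseteq> I}. K \<subset> \<psi> m} = cube_chains y (card I - card (dom m))"
  using assms(3)
proof (induction "card I - card (dom m)" arbitrary: m rule: less_induct)
  case less
  define Up where "Up m = {m'. dom m' \<subseteq> I \<and> m \<subseteq>\<^sub>m m' \<and> m' \<noteq> m}" for m :: "nat \<Rightarrow> bool option"
  have strict: "\<psi> m \<subset> \<psi> m' \<longleftrightarrow> m' \<subseteq>\<^sub>m m \<and> m' \<noteq> m" if "dom m \<subseteq> I" "dom m' \<subseteq> I" for m m'
    unfolding psubset_eq using order[OF that] order[OF that(2,1)] by (metis map_le_antisym map_le_refl subset_antisym subset_refl)
  have inj: "inj_on \<psi> {m'. dom m' \<subseteq> I}"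
    by (rule inj_onI) (metis order map_le_antisym mem_Collect_eq subset_refl)
  have Up: "{K \<in> \<psi> ` {m'. dom m' \<subseteq> I}. K \<subset> \<psi> m} = \<psi> ` Up m" if "dom m \<subseteq> I" for m
  proof -
    have "m' \<in> {m'. dom m' \<subseteq> I} \<and> \<psi> m' \<subset> \<psi> m \<longleftrightarrow> m' \<in> Up m" for m'
      using strict[of m' m] that by (cases "dom m' \<subseteq> I") (simp_all add: Up_def eq_commute[of m])
    then show ?thesis
      by blast
  qed
  define J where "J = I - dom m"
  have J: "finite J" "card J = card I - card (dom m)"
    using fin less.prems by (auto simp: J_def card_Diff_subset finite_subset)
  \<comment> \<open>With both values admissible everywhere, each free coordinate yields a factor
    \<open>t + 2\<close>.\<close>
  have finN: "finite {m' :: nat \<Rightarrow> bool option. dom m' \<subseteq> J}"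
    and prod: "(\<Sum>m'\<in>{m' :: nat \<Rightarrow> bool option. dom m' \<subseteq> J}. monom (1 :: complex) (card J - card (dom m'))) = [:2, 1:] ^ card J"
    using sum_monom_maps[OF J(1), of "\<lambda>_. UNIV"] by simp_all
  have card_dom: "card I - card (dom (m ++ m')) = card J - card (dom m')" "m ++ m' = m \<longleftrightarrow> m' = Map.empty"
     "m \<subseteq>\<^sub>m m ++ m'" "dom (m ++ m') \<subseteq> I" if "dom m' \<subseteq> J" for m'
  proof -
    have disj: "dom m \<inter> dom m' = {}" using that by (auto simp: J_def)
    have "card (dom (m ++ m')) = card (dom m) + card (dom m')"
      using disj that J fin less.prems
      by (simp add: card_Un_disjoint[of "dom m'" "dom m"] finite_subset Int_commute)
    then show "card I - card (dom (m ++ m')) = card J - card (dom m')"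
      using J by simp
    show "m ++ m' = m \<longleftrightarrow> m' = Map.empty"
      using disj by (metis dom_eq_empty_conv dom_map_add inf.commute inf_sup_absorb map_add_empty sup_commute)
    show "m \<subseteq>\<^sub>m m ++ m'"
      using disj by (simp add: map_add_comm)
    show "dom (m ++ m') \<subseteq> I"
      using that less.prems by (auto simp: J_def)
  qed
  have Up_eq: "Up m = (\<lambda>m'. m ++ m') ` ({m' :: nat \<Rightarrow> bool option. dom m' \<subseteq> J} - {Map.empty})"
  proof (intro equalityI subsetI)
    fix m' assume m': "m' \<in> Up m"
    have "m' = m ++ (m' |` J)"
    proof
      fix i
      show "m' i = (m ++ m' |` J) i"
        using m' by (cases "i \<in> dom m"; cases "i \<in> I")
          (auto simp: Up_def J_def map_add_def restrict_map_def map_le_def split: option.splits dest!: subsetD)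
    qed
    moreover have "m' |` J \<noteq> Map.empty"
      using calculation m' by (auto simp: Up_def)
    ultimately show "m' \<in> (\<lambda>m'. m ++ m') ` ({m' :: nat \<Rightarrow> bool option. dom m' \<subseteq> J} - {Map.empty})"
      by (intro image_eqI[of _ _ "m' |` J"]) auto
  next
    fix m' assume "m' \<in> (\<lambda>m'. m ++ m') ` ({m' :: nat \<Rightarrow> bool option. dom m' \<subseteq> J} - {Map.empty})"
    then obtain m'' where "dom m'' \<subseteq> J" "m'' \<noteq> Map.empty" "m' = m ++ m''"
      by blast
    then show "m' \<in> Up m"
      unfolding Up_def using card_dom(2-4)[of m''] by (simp del: dom_map_add)
  qed
  have inj2: "inj_on (\<lambda>m'. m ++ m') {m' :: nat \<Rightarrow> bool option. dom m' \<subseteq> J}"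
  proof (rule inj_onI)
    fix m1 m2 assume *: "m1 \<in> {m' :: nat \<Rightarrow> bool option. dom m' \<subseteq> J}" "m2 \<in> {m' :: nat \<Rightarrow> bool option. dom m' \<subseteq> J}" "m ++ m1 = m ++ m2"
    show "m1 = m2"
    proof
      fix i
      have "i \<notin> dom m1" "i \<notin> dom m2" if "i \<in> dom m"
        using *(1,2) that unfolding J_def mem_Collect_eq by (meson DiffD2 subsetD)+
      moreover have "(m ++ m1) i = (m ++ m2) i"
        using *(3) by simp
      ultimately show "m1 i = m2 i"
        by (cases "i \<in> dom m") (auto simp: map_add_def domIff split: option.splits)
    qed
  qed
  have finUp: "finite (Up m)"
    unfolding Up_eq using finN by simp
  have "chain_sum y (\<psi> ` Up m) = 1 + y * (\<Sum>K\<in>\<psi> ` Up m. chain_sum y {K' \<in> \<psi> ` Up m. K' \<subset> K})"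
    using finUp by (intro chain_sum_eq) simp
  also have "(\<Sum>K\<in>\<psi> ` Up m. chain_sum y {K' \<in> \<psi> ` Up m. K' \<subset> K})
      = (\<Sum>m'\<in>Up m. chain_sum y {K' \<in> \<psi> ` Up m. K' \<subset> \<psi> m'})"
    by (rule sum.reindex_cong[OF _ refl refl]) (auto intro: inj_on_subset[OF inj] simp: Up_def)
  also have "\<dots> = (\<Sum>m'\<in>Up m. cube_chains y (card I - card (dom m')))"
  proof (rule sum.cong[OF refl])
    fix m' assume m': "m' \<in> Up m"
    have I: "dom m' \<subseteq> I" and le: "m \<subseteq>\<^sub>m m'" and ne: "m' \<noteq> m"
      using m' by (auto simp only: Up_def mem_Collect_eq)
    have "\<psi> m' \<subset> \<psi> m"
      using strict[OF I less.prems] le ne by blast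
    \<comment> \<open>Everything below \<open>\<psi> m'\<close> is already below
      \<open>\<psi> m\<close>, so the induction hypothesis for \<open>m'\<close> applies.\<close>
    then have eq: "{K' \<in> \<psi> ` Up m. K' \<subset> \<psi> m'} = {K \<in> \<psi> ` {m'. dom m' \<subseteq> I}. K \<subset> \<psi> m'}"
      unfolding Up[OF less.prems, symmetric] by (blast intro: psubset_trans)
    have "dom m \<noteq> dom m'"
    proof
      assume "dom m = dom m'"
      then have "m' \<subseteq>\<^sub>m m"
        using le by (simp add: map_le_def)
      then show False
        using le ne map_le_antisym by blast
    qed
    then have "dom m \<subset> dom m'"
      using map_le_implies_dom_le[OF le] by blast
    then have "card (dom m) < card (dom m')" "card (dom m') \<le> card I"
      using psubset_card_mono[OF finite_subset[OF I fin]] card_mono[OF fin I] by auto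
    then show "chain_sum y {K' \<in> \<psi> ` Up m. K' \<subset> \<psi> m'} = cube_chains y (card I - card (dom m'))"
      unfolding eq by (intro less.hyps I) linarith
  qed
  also have "\<dots> = (\<Sum>m'\<in>{m' :: nat \<Rightarrow> bool option. dom m' \<subseteq> J} - {Map.empty}. cube_chains y (card J - card (dom m')))"
    unfolding Up_eq by (subst sum.reindex) (auto intro: inj_on_subset[OF inj2] simp: card_dom simp del: dom_map_add)
  also have "\<dots> = chain_functional y ([:2, 1:] ^ card J) - cube_chains y (card J)"
    using finN unfolding prod[symmetric]
    by (simp add: chain_functional_sum chain_functional_monom sum_diff1)
  also have "1 + y * \<dots> = cube_chains y (card J)"
    by (rule cube_chains_eq[symmetric])
  finally show ?case
    using J Up[OF less.prems] by simp
qed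

section \<open>Faces of the cube\<close>

text \<open>A nonempty face of the \<open>n\<close>-cube is encoded by the partial map of its fixed coordinates.\<close>

definition cube_face :: "nat \<Rightarrow> (nat \<Rightarrow> bool option) \<Rightarrow> (nat \<Rightarrow>\<^sub>0 real) set" where
  "cube_face n m = {x \<in> std_cube n. \<forall>i e. m i = Some e \<longrightarrow> Poly_Mapping.lookup x i = of_bool e}"

lemma lookup_scaleR: "Poly_Mapping.lookup (c *\<^sub>R x) i = c *\<^sub>R Poly_Mapping.lookup x i"
proof -
  have "finite {i. c *\<^sub>R Poly_Mapping.lookup x i \<noteq> 0}"
    by (rule finite_subset[OF _ finite_lookup[of x]]) auto
  then show ?thesis
    by (simp add: scaleR_poly_mapping_def)
qed

lemma lookup_segment:
  "Poly_Mapping.lookup ((1 - u) *\<^sub>R a + u *\<^sub>R b) i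
     = (1 - u) * Poly_Mapping.lookup a i + u * Poly_Mapping.lookup (b :: nat \<Rightarrow>\<^sub>0 real) i"
  by (simp add: lookup_add lookup_scaleR)

lemma convex_cube_face: "convex (cube_face n m)"
proof (rule convexI)
  fix x y :: "nat \<Rightarrow>\<^sub>0 real" and u v :: real
  assume "x \<in> cube_face n m" "y \<in> cube_face n m" "0 \<le> u" "0 \<le> v" and uv: "u + v = 1"
  moreover have "v = 1 - u" using uv by simp
  ultimately show "u *\<^sub>R x + v *\<^sub>R y \<in> cube_face n m"
    by (auto simp: cube_face_def std_cube_def lookup_add lookup_scaleR convex_bound_le algebra_simps)
qed

text \<open>A proper convex combination of two numbers in the unit interval equals 0 or 1 only if
  both numbers do.\<close>

lemma cube_face_face_of: "cube_face n m face_of std_cube n"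
proof -
  have "a \<in> cube_face n m \<and> b \<in> cube_face n m"
    if ab: "a \<in> std_cube n" "b \<in> std_cube n" "x \<in> cube_face n m" "x \<in> open_segment a b" for a b x
  proof -
    obtain u where u: "0 < u" "u < 1" "x = (1 - u) *\<^sub>R a + u *\<^sub>R b"
      using ab(4) by (auto simp: in_segment)
    have "Poly_Mapping.lookup a i = of_bool e \<and> Poly_Mapping.lookup b i = of_bool e" if "m i = Some e" for i e
    proof -
      let ?a = "Poly_Mapping.lookup a i" and ?b = "Poly_Mapping.lookup b i"
      have range: "0 \<le> ?a" "?a \<le> 1" "0 \<le> ?b" "?b \<le> 1"
        using ab(1,2) by (cases "i < n"; auto simp: std_cube_def)+
      have eq: "(1 - u) * ?a + u * ?b = of_bool e"
        using ab(3) that u(3) by (auto simp: cube_face_def lookup_segment)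
      have zero: "s = 0 \<and> t = 0" if "(1 - u) * s + u * t = 0" "0 \<le> s" "0 \<le> t" for s t :: real
      proof -
        have "0 \<le> (1 - u) * s" "0 \<le> u * t"
          using that u by simp_all
        then have "(1 - u) * s = 0" "u * t = 0"
          using that(1) by linarith+
        then show ?thesis using u by simp
      qed
      show ?thesis
      proof (cases e)
        case True
        have "(1 - u) * (1 - ?a) + u * (1 - ?b) = 0"
          using eq True by (simp add: algebra_simps)
        then show ?thesis
          using zero[of "1 - ?a" "1 - ?b"] range True by simp
      next
        case False
        then show ?thesis
          using zero[of ?a ?b] range eq by simp
      qed
    qed
    then show ?thesis
      using ab by (auto simp: cube_face_def)
  qed
  moreover have "cube_face n m \<subseteq> std_cube n"
    by (auto simp: cube_face_def)
  ultimately show ?thesis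
    using convex_cube_face[of n m] unfolding face_of_def by blast
qed

text \<open>The value 1/2 differs from both admissible fixed values, so such a point reveals which
  coordinates \<open>m\<close> leaves free.\<close>

lemma obtain_cube_point:
  assumes "dom m \<subseteq> {..<n}"
  obtains x where "x \<in> cube_face n m" "\<And>i. i < n \<Longrightarrow> m i = None \<Longrightarrow> Poly_Mapping.lookup x i = 1/2"
proof -
  define f :: "nat \<Rightarrow> real" where "f i = (if i < n then (case m i of None \<Rightarrow> 1/2 | Some e \<Rightarrow> of_bool e) else 0)" for i
  have "finite {i. f i \<noteq> 0}"
    by (rule finite_subset[of _ "{..<n}"]) (auto simp: f_def)
  then have f: "Poly_Mapping.lookup (Poly_Mapping.Abs_poly_mapping f) = f"
    by (simp add: Abs_poly_mapping_inverse)
  have "m i = Some e \<Longrightarrow> i < n" for i e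
    using assms by auto
  then show ?thesis
    by (intro that[of "Poly_Mapping.Abs_poly_mapping f"])
       (auto simp: cube_face_def std_cube_def f f_def split: option.splits)
qed

lemma cube_face_subset_iff:
  assumes "dom m \<subseteq> {..<n}" "dom m' \<subseteq> {..<n}"
  shows "cube_face n m \<subseteq> cube_face n m' \<longleftrightarrow> m' \<subseteq>\<^sub>m m"
proof
  assume sub: "cube_face n m \<subseteq> cube_face n m'"
  obtain x where x: "x \<in> cube_face n m" "\<And>i. i < n \<Longrightarrow> m i = None \<Longrightarrow> Poly_Mapping.lookup x i = 1/2"
    using obtain_cube_point[OF assms(1)] by blast
  have "m i = Some e" if "m' i = Some e" for i e
  proof -
    have "i < n" using that assms(2) by auto
    have *: "Poly_Mapping.lookup x i = of_bool e"
      using sub x(1) that by (auto simp: cube_face_def)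
    show ?thesis
    proof (cases "m i")
      case None
      then show ?thesis using x(2)[OF \<open>i < n\<close>] * by (cases e) auto
    next
      case (Some e')
      then have "Poly_Mapping.lookup x i = of_bool e'"
        using x(1) by (auto simp: cube_face_def)
      then show ?thesis using * Some by (cases e; cases e') auto
    qed
  qed
  then show "m' \<subseteq>\<^sub>m m"
    by (auto simp: map_le_def)
next
  assume "m' \<subseteq>\<^sub>m m"
  then show "cube_face n m \<subseteq> cube_face n m'"
    unfolding cube_face_def map_le_def by (auto simp: dom_def)
qed

text \<open>\<open>m\<close> records the coordinates constantly 0 or constantly 1 on
  \<open>F\<close>. Convexity yields a point of \<open>F\<close> whose other coordinates lie
  strictly between; segments from any point of \<open>cube_face n m\<close> can be prolonged beyond
  it within the cube, so the face property applies.\<close>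

lemma face_of_std_cube:
  assumes F: "F face_of std_cube n" "F \<noteq> {}"
  shows "\<exists>m. dom m \<subseteq> {..<n} \<and> F = cube_face n m"
proof -
  let ?l = "Poly_Mapping.lookup :: (nat \<Rightarrow>\<^sub>0 real) \<Rightarrow> nat \<Rightarrow> real"
  define P where "P i e \<longleftrightarrow> (\<forall>x\<in>F. ?l x i = of_bool e)" for i e
  define m where "m i = (if i < n \<and> (\<exists>e. P i e) then Some (SOME e. P i e) else None)" for i
  define J where "J = {i. i < n \<and> m i = None}"
  have FS: "F \<subseteq> std_cube n"
    using F face_of_imp_subset by blast
  have range: "0 \<le> ?l x i" "?l x i \<le> 1" if "x \<in> std_cube n" for x i
    using that by (cases "i < n"; auto simp: std_cube_def)+
  have fixed: "?l x i = of_bool e" if "m i = Some e" "x \<in> F" for x i e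
  proof -
    have "P i e"
      using that(1) someI_ex[of "P i"] by (auto simp: m_def split: if_splits)
    then show ?thesis
      using that(2) by (simp add: P_def)
  qed
  have free: "\<exists>x\<in>F. ?l x i \<noteq> of_bool e" if "i \<in> J" for i e
  proof -
    have "\<not> P i e"
      using that by (auto simp: J_def m_def split: if_splits)
    then show ?thesis
      by (simp add: P_def)
  qed
  have "finite J"
    by (auto simp: J_def)
  have "\<exists>x\<in>F. \<forall>i\<in>K. 0 < ?l x i \<and> ?l x i < 1" if "K \<subseteq> J" for K
    using finite_subset[OF that \<open>finite J\<close>] that
  proof (induction K rule: finite_induct)
    case empty
    then show ?case using F(2) by auto
  next
    case (insert j K)
    then obtain x where x: "x \<in> F" "\<forall>i\<in>K. 0 < ?l x i \<and> ?l x i < 1"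
      by auto
    obtain y where y: "y \<in> F" "?l y j \<noteq> 0"
      using free[of j False] insert.prems by auto
    obtain z where z: "z \<in> F" "?l z j \<noteq> 1"
      using free[of j True] insert.prems by auto
    have cvx: "convex F"
      using F(1) face_of_imp_convex by blast
    \<comment> \<open>The share of \<open>y\<close> moves coordinate \<open>j\<close> off 0, that of
      \<open>z\<close> moves it off 1, and that of \<open>x\<close> keeps the coordinates in
      \<open>K\<close> strictly inside.\<close>
    define w where "w = (1/2) *\<^sub>R x + (1/2) *\<^sub>R ((1/2) *\<^sub>R y + (1/2) *\<^sub>R z)"
    have "w \<in> F"
      unfolding w_def using x(1) y(1) z(1) by (intro convexD[OF cvx]) auto
    have w: "?l w i = (1/2) * ?l x i + (1/4) * ?l y i + (1/4) * ?l z i" for i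
      by (simp add: w_def lookup_add lookup_scaleR)
    have r: "0 \<le> ?l x i" "?l x i \<le> 1" "0 \<le> ?l y i" "?l y i \<le> 1" "0 \<le> ?l z i" "?l z i \<le> 1" for i
      using range x(1) y(1) z(1) FS by blast+
    have "0 < ?l w j \<and> ?l w j < 1"
      using r[of j] y(2) z(2) unfolding w by linarith
    moreover have "0 < ?l w i \<and> ?l w i < 1" if "i \<in> K" for i
    proof -
      have "0 < ?l x i \<and> ?l x i < 1" using x(2) that by blast
      then show ?thesis using r[of i] unfolding w by linarith
    qed
    ultimately show ?case
      using \<open>w \<in> F\<close> by auto
  qed
  then obtain x where x: "x \<in> F" "\<And>i. i \<in> J \<Longrightarrow> 0 < ?l x i \<and> ?l x i < 1"
    by blast
  have "cube_face n m \<subseteq> F"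
  proof
    fix p assume p: "p \<in> cube_face n m"
    show "p \<in> F"
    proof (cases "p = x")
      case False
      have ev: "eventually (\<lambda>t. 0 \<le> ?l x i + t * (?l x i - ?l p i) \<and> ?l x i + t * (?l x i - ?l p i) \<le> 1) (at_right 0)"
        if "i < n" for i
      proof (cases "m i")
        case None
        then have "0 < ?l x i" "?l x i < 1" using x(2) that by (auto simp: J_def)
        moreover have "((\<lambda>t. ?l x i + t * (?l x i - ?l p i)) \<longlongrightarrow> ?l x i + 0 * (?l x i - ?l p i)) (at_right 0)"
          by (intro tendsto_intros)
        ultimately have "eventually (\<lambda>t. 0 < ?l x i + t * (?l x i - ?l p i)) (at_right 0)"
            "eventually (\<lambda>t. ?l x i + t * (?l x i - ?l p i) < 1) (at_right 0)"
          by (auto intro: order_tendstoD)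
        then show ?thesis
          by eventually_elim auto
      next
        case (Some e)
        then have "?l x i = of_bool e" "?l p i = of_bool e"
          using fixed x(1) p by (auto simp: cube_face_def)
        then show ?thesis by simp
      qed
      have "eventually (\<lambda>t. \<forall>i\<in>{..<n}. 0 \<le> ?l x i + t * (?l x i - ?l p i) \<and> ?l x i + t * (?l x i - ?l p i) \<le> 1) (at_right 0)"
        by (intro eventually_ball_finite) (use ev in auto)
      moreover have "eventually (\<lambda>t::real. 0 < t) (at_right 0)"
        by (rule eventually_at_right_less)
      ultimately have "eventually (\<lambda>t. 0 < t \<and> (\<forall>i\<in>{..<n}. 0 \<le> ?l x i + t * (?l x i - ?l p i) \<and> ?l x i + t * (?l x i - ?l p i) \<le> 1)) (at_right 0)"
        by eventually_elim auto
      then obtain t where t: "0 < t" "\<forall>i\<in>{..<n}. 0 \<le> ?l x i + t * (?l x i - ?l p i) \<and> ?l x i + t * (?l x i - ?l p i) \<le> 1"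
        using eventually_happens trivial_limit_at_right_real by blast
      \<comment> \<open>\<open>q\<close> lies slightly beyond \<open>x\<close> on the ray from
        \<open>p\<close>, which puts \<open>x\<close> inside the segment from \<open>p\<close> to
        \<open>q\<close>.\<close>
      define q where "q = x + t *\<^sub>R (x - p)"
      have l: "?l q i = ?l x i + t * (?l x i - ?l p i)" for i
        by (simp add: q_def lookup_add lookup_scaleR lookup_minus)
      have "p \<in> std_cube n" "x \<in> std_cube n"
        using p x FS by (auto simp: cube_face_def)
      then have "q \<in> std_cube n"
        using t by (auto simp: std_cube_def l)
      have "x = (1 - 1 / (1 + t)) *\<^sub>R p + (1 / (1 + t)) *\<^sub>R q"
      proof (rule poly_mapping_eqI)
        fix i show "?l x i = ?l ((1 - 1 / (1 + t)) *\<^sub>R p + (1 / (1 + t)) *\<^sub>R q) i"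
        proof -
          define u where "u = 1 / (1 + t)"
          have "u * (1 + t) = 1"
            using t(1) by (simp add: u_def)
          moreover have "(1 - u) * ?l p i + u * ?l q i = ?l p i + (u * (1 + t)) * (?l x i - ?l p i)"
            by (simp add: l algebra_simps)
          ultimately show ?thesis
            unfolding lookup_segment u_def[symmetric] by simp
        qed
      qed
      moreover have "p \<noteq> q"
      proof
        assume "p = q"
        then have "(1 + t) *\<^sub>R (x - p) = 0"
          by (simp add: q_def algebra_simps)
        then show False using t False by auto
      qed
      ultimately have "x \<in> open_segment p q"
        unfolding in_segment using t(1) by (auto intro!: exI[of _ "1 / (1 + t)"])
      then show ?thesis
        using face_ofD[OF F(1) _ \<open>p \<in> std_cube n\<close> \<open>q \<in> std_cube n\<close> x(1)] by blast
    qed (use x in simp)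
  qed
  moreover have "F \<subseteq> cube_face n m"
    using fixed FS by (auto simp: cube_face_def)
  moreover have "dom m \<subseteq> {..<n}"
    by (auto simp: m_def split: if_splits)
  ultimately show ?thesis by blast
qed

text \<open>The labels are pulled back along the isomorphism. It matches the empty faces, being the
  least elements, so nonempty faces correspond as well.\<close>

lemma combinatorial_cube_labelling:
  assumes "combinatorially_equivalent (faces Q) (faces (std_cube k))"
  obtains \<psi> :: "(nat \<Rightarrow> bool option) \<Rightarrow> 'a::real_vector set" where
    "\<And>m m'. dom m \<subseteq> {..<k} \<Longrightarrow> dom m' \<subseteq> {..<k} \<Longrightarrow> \<psi> m \<subseteq> \<psi> m' \<longleftrightarrow> m' \<subseteq>\<^sub>m m"
    "\<psi> ` {m. dom m \<subseteq> {..<k}} = {K. K face_of Q \<and> K \<noteq> {}}"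
proof -
  let ?M = "{m :: nat \<Rightarrow> bool option. dom m \<subseteq> {..<k}}"
  obtain \<phi> where bij: "bij_betw \<phi> (faces Q) (faces (std_cube k))"
    and ord: "\<And>F G. F \<in> faces Q \<Longrightarrow> G \<in> faces Q \<Longrightarrow> F \<subseteq> G \<longleftrightarrow> \<phi> F \<subseteq> \<phi> G"
    using assms unfolding combinatorially_equivalent_def by auto
  define \<psi> where "\<psi> m = inv_into (faces Q) \<phi> (cube_face k m)" for m
  have empty: "{} \<in> faces Q" "{} \<in> faces (std_cube k)"
    by (simp_all add: faces_def)
  have surj: "\<phi> ` faces Q = faces (std_cube k)"
    using bij by (rule bij_betw_imp_surj_on)
  have "{} \<in> \<phi> ` faces Q"
    using surj empty(2) by simp
  then obtain E where "{} = \<phi> E" "E \<in> faces Q"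
    by (rule imageE)
  then have \<phi>_empty: "\<phi> {} = {}"
    using ord[OF empty(1), of E] by auto
  have face: "cube_face k m \<in> faces (std_cube k)" for m
    by (simp add: faces_def cube_face_face_of)
  have \<psi>: "\<psi> m \<in> faces Q" "\<phi> (\<psi> m) = cube_face k m" for m
    using bij face[of m] unfolding \<psi>_def surj[symmetric] by (simp_all add: inv_into_into f_inv_into_f)
  have order: "\<psi> m \<subseteq> \<psi> m' \<longleftrightarrow> m' \<subseteq>\<^sub>m m" if "dom m \<subseteq> {..<k}" "dom m' \<subseteq> {..<k}" for m m'
    using ord[OF \<psi>(1) \<psi>(1), of m m'] cube_face_subset_iff[OF that] by (simp add: \<psi>)
  have "\<psi> ` ?M = {K. K face_of Q \<and> K \<noteq> {}}"
  proof (intro equalityI subsetI)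
    fix K assume "K \<in> \<psi> ` ?M"
    then obtain m where m: "m \<in> ?M" "K = \<psi> m" by blast
    then have "dom m \<subseteq> {..<k}"
      by simp
    then obtain x where "x \<in> cube_face k m"
      by (rule obtain_cube_point)
    then have "K \<noteq> {}"
      using \<psi>(2)[of m] \<phi>_empty m(2) by auto
    then show "K \<in> {K. K face_of Q \<and> K \<noteq> {}}"
      using \<psi>(1)[of m] m by (simp add: faces_def)
  next
    fix K assume "K \<in> {K. K face_of Q \<and> K \<noteq> {}}"
    then have K: "K \<in> faces Q" "K \<noteq> {}"
      by (simp_all add: faces_def)
    have inj: "inj_on \<phi> (faces Q)"
      using bij bij_betw_imp_inj_on by blast
    have "\<phi> K \<noteq> {}"
    proof
      assume "\<phi> K = {}"
      then show False
        using inj_onD[OF inj _ K(1) empty(1)] K(2) \<phi>_empty by simp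
    qed
    moreover have "\<phi> K face_of std_cube k"
      using bij_betw_apply[OF bij K(1)] by (simp add: faces_def)
    ultimately obtain m where "dom m \<subseteq> {..<k}" "\<phi> K = cube_face k m"
      using face_of_std_cube[of "\<phi> K" k] by blast
    moreover have "\<psi> m = K"
      using inj_onD[OF inj _ \<psi>(1) K(1)] \<psi>(2) calculation by simp
    ultimately show "K \<in> \<psi> ` ?M" by blast
  qed
  note img = this
  show ?thesis
    by (rule that[of \<psi>]) (fact order img)+
qed

section \<open>Combinatorial cubes\<close>

text \<open>Inclusion is reversed: fixing more coordinates gives a smaller face. The number
  \<open>k\<close> is purely combinatorial here; \<open>aff_dim_eq\<close> identifies it with the
  dimension.\<close>

locale labelled_cube =
  fixes Q :: "'a::euclidean_space set" and k :: nat and \<psi> :: "(nat \<Rightarrow> bool option) \<Rightarrow> 'a set"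
  assumes polytope: "polytope Q"
    and order: "\<And>m m'. dom m \<subseteq> {..<k} \<Longrightarrow> dom m' \<subseteq> {..<k} \<Longrightarrow> \<psi> m \<subseteq> \<psi> m' \<longleftrightarrow> m' \<subseteq>\<^sub>m m"
    and image: "\<psi> ` {m. dom m \<subseteq> {..<k}} = {K. K face_of Q \<and> K \<noteq> {}}"
begin

lemma label_face: "dom m \<subseteq> {..<k} \<Longrightarrow> \<psi> m face_of Q" "dom m \<subseteq> {..<k} \<Longrightarrow> \<psi> m \<noteq> {}"
  using image by blast+

lemma face_label:
  assumes "K face_of Q" "K \<noteq> {}"
  obtains m where "dom m \<subseteq> {..<k}" "K = \<psi> m"
proof -
  have "K \<in> \<psi> ` {m. dom m \<subseteq> {..<k}}"
    using assms image by simp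
  then show ?thesis
    using that by blast
qed

lemma label_eq_iff:
  assumes "dom m \<subseteq> {..<k}" "dom m' \<subseteq> {..<k}"
  shows "\<psi> m = \<psi> m' \<longleftrightarrow> m = m'"
  using order[OF assms] order[OF assms(2,1)] by (auto intro: map_le_antisym)

lemma label_empty: "\<psi> Map.empty = Q"
proof -
  have "\<psi> Map.empty \<subseteq> Q" "\<psi> Map.empty \<noteq> {}"
    using label_face[of Map.empty] face_of_imp_subset by auto
  moreover from this have "Q face_of Q" "Q \<noteq> {}"
    using polytope polytope_imp_convex face_of_refl by auto
  then obtain m where "dom m \<subseteq> {..<k}" "Q = \<psi> m"
    by (rule face_label)
  then have "Q \<subseteq> \<psi> Map.empty"
    using order[of m Map.empty] by simp
  ultimately show ?thesis by blast
qed

lemma card_dom: "dom m \<subseteq> {..<k} \<Longrightarrow> card (dom m) \<le> k"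
  using card_mono[of "{..<k}" "dom m"] by simp

text \<open>Induction on the number of free coordinates. A point has no smaller nonempty face, so
  all its coordinates are fixed. Otherwise, fixing one coordinate as a facet of
  \<open>\<psi> m\<close> does gives a proper face containing that facet, so the dimension drops by
  exactly one.\<close>

lemma aff_dim_label:
  assumes "dom m \<subseteq> {..<k}"
  shows "aff_dim (\<psi> m) = int (k - card (dom m))"
  using assms
proof (induction "k - card (dom m)" arbitrary: m rule: less_induct)
  case less
  note m = less.prems
  have fin: "finite (dom m)"
    using m finite_subset by blast
  have poly: "polytope (\<psi> m)"
    using face_of_polytope_polytope[OF polytope] label_face(1)[OF m] by blast
  have ext: "dom (m(i \<mapsto> b)) \<subseteq> {..<k}" "\<psi> (m(i \<mapsto> b)) \<subset> \<psi> m" "card (dom (m(i \<mapsto> b))) = Suc (card (dom m))"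
    if "i < k" "i \<notin> dom m" for i b
  proof -
    show d: "dom (m(i \<mapsto> b)) \<subseteq> {..<k}"
      using m that by auto
    have "m \<subseteq>\<^sub>m m(i \<mapsto> b)"
      using that by (auto simp: map_le_def)
    moreover have "m \<noteq> m(i \<mapsto> b)"
      using that by (metis domI fun_upd_same)
    ultimately show "\<psi> (m(i \<mapsto> b)) \<subset> \<psi> m"
      unfolding psubset_eq order[OF d m] label_eq_iff[OF d m] by metis
    show "card (dom (m(i \<mapsto> b))) = Suc (card (dom m))"
      using that(2) fin by simp
  qed
  show ?case
  proof (cases "aff_dim (\<psi> m) > 0")
    case False
    moreover have "aff_dim (\<psi> m) \<ge> 0"
      using label_face(2)[OF m] aff_dim_negative_iff[of "\<psi> m"] by linarith
    ultimately have 0: "aff_dim (\<psi> m) = 0" by linarith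
    then obtain a where a: "\<psi> m = {a}"
      using aff_dim_eq_0 by blast
    have "i \<in> dom m" if "i < k" for i
    proof (rule ccontr)
      assume "i \<notin> dom m"
      note e = ext(1,2)[OF that this, of True]
      have "\<psi> (m(i \<mapsto> True)) = {}"
        using e(2) unfolding a by auto
      then show False
        using label_face(2)[OF e(1)] by simp
    qed
    then have "dom m = {..<k}" using m by blast
    then show ?thesis using 0 by simp
  next
    case True
    then obtain F where F: "F facet_of \<psi> m"
      using polytope_facet_exists[OF poly] by blast
    have "F face_of Q" "F \<noteq> {}"
      using F face_of_trans[OF facet_of_imp_face_of[OF F] label_face(1)[OF m]]
      by (simp_all add: facet_of_def)
    then obtain m' where m': "dom m' \<subseteq> {..<k}" "F = \<psi> m'"
      by (rule face_label)
    have "F \<subseteq> \<psi> m" "F \<noteq> \<psi> m"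
      using facet_of_imp_subset[OF F] F facet_of_irrefl by blast+
    then have mm': "m \<subseteq>\<^sub>m m'" "m \<noteq> m'"
      using order[OF m'(1) m] m'(2) by auto
    obtain i where i: "i \<in> dom m'" "i \<notin> dom m"
    proof -
      have "dom m \<noteq> dom m'"
        using mm' map_le_antisym[of m m'] by (auto simp: map_le_def)
      then show ?thesis
        using map_le_implies_dom_le[OF mm'(1)] that by blast
    qed
    then obtain b where b: "m' i = Some b" by blast
    have "i < k" using i(1) m'(1) by auto
    note ext = ext[OF this i(2), of b]
    have "m(i \<mapsto> b) \<subseteq>\<^sub>m m'"
      using mm'(1) b by (auto simp: map_le_def)
    then have sub: "F \<subseteq> \<psi> (m(i \<mapsto> b))"
      using order[OF m'(1) ext(1)] m'(2) by simp
    have "\<psi> (m(i \<mapsto> b)) face_of \<psi> m"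
      by (rule face_of_subset[OF label_face(1)[OF ext(1)]])
        (use ext(2) face_of_imp_subset[OF label_face(1)[OF m]] in blast)+
    then have "aff_dim (\<psi> (m(i \<mapsto> b))) < aff_dim (\<psi> m)"
      using face_of_aff_dim_lt[OF polytope_imp_convex[OF poly]] ext(2) by blast
    moreover have "aff_dim (\<psi> m) - 1 \<le> aff_dim (\<psi> (m(i \<mapsto> b)))"
      using F aff_dim_subset[OF sub] by (simp add: facet_of_def)
    moreover have "aff_dim (\<psi> (m(i \<mapsto> b))) = int (k - Suc (card (dom m)))"
      using less.hyps[OF _ ext(1)] card_dom[OF ext(1)] unfolding ext(3) by simp
    ultimately show ?thesis
      using card_dom[OF ext(1)] unfolding ext(3) by linarith
  qed
qed

lemma aff_dim_eq: "aff_dim Q = int k"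
  using aff_dim_label[of Map.empty] label_empty by simp

lemma facet_iff: "R facet_of Q \<longleftrightarrow> (\<exists>i b. i < k \<and> R = \<psi> [i \<mapsto> b])"
proof
  assume R: "R facet_of Q"
  then have "R face_of Q" "R \<noteq> {}" "aff_dim R = int k - 1"
    by (auto simp: facet_of_def aff_dim_eq)
  then obtain m where m: "dom m \<subseteq> {..<k}" "R = \<psi> m" and "int (k - card (dom m)) = int k - 1"
    using face_label aff_dim_label by metis
  then have "card (dom m) = 1"
    using card_dom[OF m(1)] by linarith
  then obtain i where i: "dom m = {i}"
    by (rule card_1_singletonE)
  then obtain b where "m i = Some b" by blast
  then have "m = [i \<mapsto> b]"
    using i by (auto simp: fun_eq_iff)
  then show "\<exists>i b. i < k \<and> R = \<psi> [i \<mapsto> b]"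
    using m i by auto
next
  assume "\<exists>i b. i < k \<and> R = \<psi> [i \<mapsto> b]"
  then obtain i b where "i < k" "R = \<psi> [i \<mapsto> b]" by blast
  then show "R facet_of Q"
    using label_face[of "[i \<mapsto> b]"] aff_dim_label[of "[i \<mapsto> b]"]
    by (auto simp: facet_of_def aff_dim_eq)
qed

text \<open>All \<open>k\<close> coordinates are fixed, so the face has dimension 0 and the choice
  picks its only point.\<close>

definition vertex :: "nat set \<Rightarrow> 'a" where
  "vertex X = (SOME x. x \<in> \<psi> (\<lambda>i. if i < k then Some (i \<in> X) else None))"

text \<open>If the vertex lies in the facet, the two faces meet in a nonempty face whose label
  extends both labels; hence these agree at \<open>i\<close>.\<close>

lemma vertex_in_facet_iff:
  assumes "i < k"
  shows "vertex X \<in> \<psi> [i \<mapsto> b] \<longleftrightarrow> b = (i \<in> X)"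
proof -
  define m where "m = (\<lambda>i. if i < k then Some (i \<in> X) else None)"
  have m: "dom m \<subseteq> {..<k}" and i: "dom [i \<mapsto> b] \<subseteq> {..<k}"
    using assms by (auto simp: m_def split: if_splits)
  have v: "vertex X \<in> \<psi> m"
    unfolding vertex_def m_def[symmetric] using label_face(2)[OF m] by (simp add: some_in_eq)
  show ?thesis
  proof
    assume "b = (i \<in> X)"
    then have "[i \<mapsto> b] \<subseteq>\<^sub>m m"
      using assms by (auto simp: map_le_def m_def)
    then show "vertex X \<in> \<psi> [i \<mapsto> b]"
      using order[OF m i] v by blast
  next
    assume "vertex X \<in> \<psi> [i \<mapsto> b]"
    then have "\<psi> m \<inter> \<psi> [i \<mapsto> b] \<noteq> {}" "\<psi> m \<inter> \<psi> [i \<mapsto> b] face_of Q"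
      using v label_face(1)[OF m] label_face(1)[OF i] face_of_Int by blast+
    then obtain m' where m': "dom m' \<subseteq> {..<k}" "\<psi> m \<inter> \<psi> [i \<mapsto> b] = \<psi> m'"
      using face_label by metis
    then have "m \<subseteq>\<^sub>m m'" "[i \<mapsto> b] \<subseteq>\<^sub>m m'"
      using order[OF m'(1) m] order[OF m'(1) i] by blast+
    moreover have "i \<in> dom m" "i \<in> dom [i \<mapsto> b]"
      using assms by (simp_all add: m_def dom_def)
    ultimately have "m i = m' i" "[i \<mapsto> b] i = m' i"
      unfolding map_le_def by blast+
    then have "m i = [i \<mapsto> b] i"
      by (simp only:)
    then show "b = (i \<in> X)"
      using assms by (auto simp: m_def)
  qed
qed

lemma vertex_in: "vertex X \<in> Q"
proof -
  define m where "m = (\<lambda>i. if i < k then Some (i \<in> X) else None)"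
  have m: "dom m \<subseteq> {..<k}"
    by (auto simp: m_def split: if_splits)
  have "vertex X \<in> \<psi> m"
    unfolding vertex_def m_def[symmetric] using label_face(2)[OF m] by (simp add: some_in_eq)
  then show ?thesis
    using label_face(1)[OF m] face_of_imp_subset by blast
qed

end

section \<open>Sign patterns at the vertices of a cube\<close>

text \<open>Small perturbations keep finitely many strict conditions, so the vectors of
  \<open>C\<close> can be handled one at a time. This supplies both a generic sweep direction and a
  functional separating vertices.\<close>

lemma generic_direction:
  fixes D C E :: "'a::euclidean_space set"
  assumes D: "subspace D" and fin: "finite C" "finite E"
    and C: "\<And>c. c \<in> C \<Longrightarrow> \<exists>d\<in>D. c \<bullet> d \<noteq> 0"
    and \<phi>\<^sub>0: "\<phi>\<^sub>0 \<in> D" "\<And>e. e \<in> E \<Longrightarrow> \<phi>\<^sub>0 \<bullet> e > 0"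
  shows "\<exists>\<phi>\<in>D. (\<forall>e\<in>E. \<phi> \<bullet> e > 0) \<and> (\<forall>c\<in>C. c \<bullet> \<phi> \<noteq> 0)"
  using fin(1) C
proof (induction C rule: finite_induct)
  case empty
  then show ?case using \<phi>\<^sub>0 by auto
next
  case (insert c C)
  then obtain \<phi> where \<phi>: "\<phi> \<in> D" "\<forall>e\<in>E. \<phi> \<bullet> e > 0" "\<forall>c\<in>C. c \<bullet> \<phi> \<noteq> 0"
    by auto
  obtain d where d: "d \<in> D" "c \<bullet> d \<noteq> 0"
    using insert.prems[of c] by auto
  have lim: "((\<lambda>t. (\<phi> + t *\<^sub>R d) \<bullet> x) \<longlongrightarrow> (\<phi> + 0 *\<^sub>R d) \<bullet> x) (at_right 0)" for x
    by (intro tendsto_intros)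
  have "eventually (\<lambda>t. \<forall>e\<in>E. (\<phi> + t *\<^sub>R d) \<bullet> e > 0) (at_right 0)"
    using \<phi>(2) fin(2) by (intro eventually_ball_finite ballI order_tendstoD(1)[OF lim]) auto
  moreover have "eventually (\<lambda>t. \<forall>c\<in>C. (\<phi> + t *\<^sub>R d) \<bullet> c \<noteq> 0) (at_right 0)"
    using \<phi>(3) insert.hyps(1)
    by (intro eventually_ball_finite ballI tendsto_imp_eventually_ne[OF lim]) (auto simp: inner_commute)
  moreover have "eventually (\<lambda>t. (\<phi> + t *\<^sub>R d) \<bullet> c \<noteq> 0) (at_right 0)"
  proof (cases "\<phi> \<bullet> c = 0")
    case True
    have "eventually (\<lambda>t::real. 0 < t) (at_right 0)"
      by (rule eventually_at_right_less)
    then show ?thesis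
      by eventually_elim (use True d(2) in \<open>simp add: inner_add_left inner_commute[of d c]\<close>)
  next
    case False
    then show ?thesis
      by (intro tendsto_imp_eventually_ne[OF lim]) simp
  qed
  ultimately have "eventually (\<lambda>t. (\<forall>e\<in>E. (\<phi> + t *\<^sub>R d) \<bullet> e > 0) \<and>
      (\<forall>c\<in>insert c C. c \<bullet> (\<phi> + t *\<^sub>R d) \<noteq> 0)) (at_right 0)"
    by eventually_elim (auto simp: inner_commute)
  then obtain t where "(\<forall>e\<in>E. (\<phi> + t *\<^sub>R d) \<bullet> e > 0) \<and> (\<forall>c\<in>insert c C. c \<bullet> (\<phi> + t *\<^sub>R d) \<noteq> 0)"
    using eventually_happens trivial_limit_at_right_real by blast
  moreover have "\<phi> + t *\<^sub>R d \<in> D"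
    using D \<phi>(1) d(1) by (simp add: subspace_add subspace_scale)
  ultimately show ?case by blast
qed

text \<open>Biorthogonality gives independence, the cardinality gives spanning, and pairing with
  \<open>\<alpha> i\<close> reads off coefficients. At a cube vertex \<open>d\<close> will be the
  edges and \<alpha> the normals of the facets through it.\<close>

lemma dual_family_expansion:
  fixes D :: "'a::euclidean_space set" and d \<alpha> :: "'i \<Rightarrow> 'a"
  assumes I: "finite I" "card I = dim D" and d: "\<And>i. i \<in> I \<Longrightarrow> d i \<in> D"
    and dual: "\<And>i j. i \<in> I \<Longrightarrow> j \<in> I \<Longrightarrow> i \<noteq> j \<Longrightarrow> \<alpha> i \<bullet> d j = 0"
    and nz: "\<And>i. i \<in> I \<Longrightarrow> \<alpha> i \<bullet> d i \<noteq> 0" and e: "e \<in> D"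
  shows "e = (\<Sum>i\<in>I. ((\<alpha> i \<bullet> e) / (\<alpha> i \<bullet> d i)) *\<^sub>R d i)"
proof -
  have inj: "inj_on d I"
    by (rule inj_onI) (metis dual nz)
  have app: "\<alpha> j \<bullet> (\<Sum>i\<in>I. f i *\<^sub>R d i) = f j * (\<alpha> j \<bullet> d j)" if "j \<in> I" for f j
  proof -
    have "\<alpha> j \<bullet> (\<Sum>i\<in>I. f i *\<^sub>R d i) = (\<Sum>i\<in>I. if i = j then f j * (\<alpha> j \<bullet> d j) else 0)"
      unfolding inner_sum_right using that dual by (intro sum.cong) auto
    then show ?thesis
      using I(1) that by simp
  qed
  have "independent (d ` I)"
  proof (rule independent_if_scalars_zero)
    fix f x assume *: "(\<Sum>x\<in>d ` I. f x *\<^sub>R x) = 0" "x \<in> d ` I"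
    then obtain j where j: "j \<in> I" "x = d j" by blast
    have "(\<Sum>i\<in>I. f (d i) *\<^sub>R d i) = 0"
      using *(1) by (simp add: sum.reindex[OF inj])
    then show "f x = 0"
      using app[OF j(1), of "\<lambda>i. f (d i)"] nz[OF j(1)] j(2) by simp
  qed (use I in simp)
  then have "D \<subseteq> span (d ` I)"
    using I d by (intro card_ge_dim_independent) (auto simp: card_image[OF inj])
  then obtain f where f: "e = (\<Sum>x\<in>d ` I. f x *\<^sub>R x)"
    using e I(1) unfolding span_finite[OF finite_imageI[OF I(1)]] by blast
  then have *: "e = (\<Sum>i\<in>I. f (d i) *\<^sub>R d i)"
    by (simp add: sum.reindex[OF inj])
  have "(\<alpha> j \<bullet> e) / (\<alpha> j \<bullet> d j) = f (d j)" if "j \<in> I" for j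
    unfolding * using app[OF that, of "\<lambda>i. f (d i)"] nz[OF that] by simp
  then show ?thesis
    using * by (metis (mono_tags, lifting) sum.cong)
qed

text \<open>The counting argument for unique sink orientations of a cube: if every face has a unique sink,
  then every set of directions is the set of outgoing edges at some vertex.\<close>

lemma exists_outmap:
  fixes out :: "'i set \<Rightarrow> 'i set"
  assumes fin: "finite I" and out: "\<And>X. X \<subseteq> I \<Longrightarrow> out X \<subseteq> I"
    and count: "\<And>T. T \<subseteq> I \<Longrightarrow> card {X \<in> Pow I. out X \<subseteq> T} = 2 ^ card T"
    and T: "T \<subseteq> I"
  shows "\<exists>X \<subseteq> I. out X = T"
proof -
  \<comment> \<open>Of the \<open>2 ^ card T\<close> sets counted for \<open>T\<close>, each proper
    subset of \<open>T\<close> accounts for exactly one by induction, which leaves one for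
    \<open>T\<close> itself.\<close>
  have "card {X \<in> Pow I. out X = T} = 1" if "T \<subseteq> I" for T
    using finite_subset[OF that fin] that
  proof (induction T rule: finite_psubset_induct)
    case (psubset T)
    have "{X \<in> Pow I. out X \<subseteq> T} = (\<Union>U\<in>Pow T. {X \<in> Pow I. out X = U})"
      by blast
    then have "2 ^ card T = card (\<Union>U\<in>Pow T. {X \<in> Pow I. out X = U})"
      using count[OF psubset.prems] by simp
    also have "\<dots> = (\<Sum>U\<in>Pow T. card {X \<in> Pow I. out X = U})"
      using psubset.hyps fin by (intro card_UN_disjoint) auto
    also have "\<dots> = card {X \<in> Pow I. out X = T} + (\<Sum>U\<in>Pow T - {T}. card {X \<in> Pow I. out X = U})"
      using psubset.hyps by (intro sum.remove) auto
    also have "(\<Sum>U\<in>Pow T - {T}. card {X \<in> Pow I. out X = U}) = (\<Sum>U\<in>Pow T - {T}. 1)"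
    proof (rule sum.cong[OF refl])
      fix U assume "U \<in> Pow T - {T}"
      then have "U \<subset> T" by blast
      then show "card {X \<in> Pow I. out X = U} = 1"
        using psubset.prems by (intro psubset.IH) auto
    qed
    also have "\<dots> = 2 ^ card T - 1"
      using psubset.hyps by (simp add: card_Pow)
    finally show ?case
      using one_le_power[of "2 :: nat" "card T"] by linarith
  qed
  from this[OF T] obtain X where "{X \<in> Pow I. out X = T} = {X}"
    by (rule card_1_singletonE)
  then have "X \<in> {X \<in> Pow I. out X = T}"
    by simp
  then show ?thesis by auto
qed

text \<open>At a vertex \<open>v X\<close> whose \<open>\<phi>\<close>-increasing edges are exactly those in the directions \<open>T\<close>, expanding
  \<open>e X\<close> along the edges gives a combination whose terms all have nonpositive \<open>\<phi>\<close>-value.\<close>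

lemma cube_sign_contradiction:
  fixes v e :: "nat set \<Rightarrow> 'a::euclidean_space" and \<alpha> :: "nat \<Rightarrow> bool \<Rightarrow> 'a"
  assumes D: "dim D = k" and vD: "\<And>X Y. X \<subseteq> {..<k} \<Longrightarrow> Y \<subseteq> {..<k} \<Longrightarrow> v X - v Y \<in> D"
    and le: "\<And>X i b. X \<subseteq> {..<k} \<Longrightarrow> i < k \<Longrightarrow> \<alpha> i b \<bullet> v X \<le> \<beta> i b"
    and eq: "\<And>X i b. X \<subseteq> {..<k} \<Longrightarrow> i < k \<Longrightarrow> \<alpha> i b \<bullet> v X = \<beta> i b \<longleftrightarrow> b = (i \<in> X)"
    and eD: "\<And>X. X \<subseteq> {..<k} \<Longrightarrow> e X \<in> D"
    and T: "T \<subseteq> {..<k}"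
    and pos: "\<And>X i. X \<subseteq> {..<k} \<Longrightarrow> i \<in> T \<Longrightarrow> \<alpha> i (i \<in> X) \<bullet> e X > 0"
    and neg: "\<And>X i. X \<subseteq> {..<k} \<Longrightarrow> i < k \<Longrightarrow> i \<notin> T \<Longrightarrow> \<alpha> i (i \<in> X) \<bullet> e X < 0"
    and \<phi>: "\<And>X. X \<subseteq> {..<k} \<Longrightarrow> \<phi> \<bullet> e X > 0"
    and generic: "\<And>X Y. X \<subseteq> {..<k} \<Longrightarrow> Y \<subseteq> {..<k} \<Longrightarrow> X \<noteq> Y \<Longrightarrow> \<phi> \<bullet> v X \<noteq> \<phi> \<bullet> v Y"
  shows False
proof -
  \<comment> \<open>\<open>flip X i\<close> is the neighbouring vertex in direction
    \<open>i\<close>, \<open>d X i\<close> the edge to it, and \<open>out X\<close> the set of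
    \<phi>-increasing edges.\<close>
  define flip where "flip X i = (if i \<in> X then X - {i} else insert i X)" for X and i :: nat
  define d where "d X i = v (flip X i) - v X" for X i
  define out where "out X = {i\<in>{..<k}. \<phi> \<bullet> d X i > 0}" for X
  have flip: "flip X i \<subseteq> {..<k}" "i \<in> flip X i \<longleftrightarrow> i \<notin> X" "\<And>j. j \<noteq> i \<Longrightarrow> j \<in> flip X i \<longleftrightarrow> j \<in> X"
    if "X \<subseteq> {..<k}" "i < k" for X i
    using that by (auto simp: flip_def)
  have d_off: "\<alpha> i (i \<in> X) \<bullet> d X j = 0" if "X \<subseteq> {..<k}" "i < k" "j < k" "i \<noteq> j" for X i j
    using eq[OF that(1,2), of "i \<in> X"] eq[OF flip(1)[OF that(1,3)] that(2), of "i \<in> X"]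
      flip(3)[OF that(1,3,4)]
    by (simp add: d_def inner_diff_right)
  have d_diag: "\<alpha> i (i \<in> X) \<bullet> d X i < 0" if "X \<subseteq> {..<k}" "i < k" for X i
    using eq[OF that, of "i \<in> X"] eq[OF flip(1)[OF that] that(2), of "i \<in> X"] flip(2)[OF that]
      le[OF flip(1)[OF that] that(2), of "i \<in> X"]
    by (simp add: d_def inner_diff_right)
  have expand: "x = (\<Sum>i<k. ((\<alpha> i (i \<in> X) \<bullet> x) / (\<alpha> i (i \<in> X) \<bullet> d X i)) *\<^sub>R d X i)"
    if "X \<subseteq> {..<k}" "x \<in> D" for X x
  proof (rule dual_family_expansion)
    show "d X i \<in> D" if "i \<in> {..<k}" for i
      unfolding d_def using that \<open>X \<subseteq> {..<k}\<close> flip(1) by (intro vD) auto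
    show "\<alpha> i (i \<in> X) \<bullet> d X i \<noteq> 0" if "i \<in> {..<k}" for i
      using d_diag[OF \<open>X \<subseteq> {..<k}\<close>, of i] that by simp
  qed (use D that d_off in auto)
  \<comment> \<open>A vertex with no outgoing edge in the directions \<open>S\<close> maximises
    \<phi> among the vertices agreeing with it off \<open>S\<close>: the difference is a nonnegative
    combination of its edges in those directions.\<close>
  have sink: "\<phi> \<bullet> v Y \<le> \<phi> \<bullet> v X"
    if XY: "X \<subseteq> {..<k}" "Y \<subseteq> {..<k}" "X - S = Y - S" "out X \<inter> S = {}" for X Y S
  proof -
    let ?c = "\<lambda>i. (\<alpha> i (i \<in> X) \<bullet> (v Y - v X)) / (\<alpha> i (i \<in> X) \<bullet> d X i)"
    have "\<phi> \<bullet> (v Y - v X) = (\<Sum>i<k. ?c i * (\<phi> \<bullet> d X i))"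
      by (subst expand[OF XY(1) vD[OF XY(2,1)]]) (simp add: inner_sum_right)
    also have "\<dots> \<le> 0"
    proof (rule sum_nonpos)
      fix i assume "i \<in> {..<k}"
      then have i: "i < k" by simp
      show "?c i * (\<phi> \<bullet> d X i) \<le> 0"
      proof (cases "i \<in> S")
        case True
        have "\<alpha> i (i \<in> X) \<bullet> (v Y - v X) \<le> 0"
          using le[OF XY(2) i, of "i \<in> X"] eq[OF XY(1) i, of "i \<in> X"] by (simp add: inner_diff_right)
        then have "?c i \<ge> 0"
          using d_diag[OF XY(1) i] by (simp add: divide_nonpos_neg)
        moreover have "\<phi> \<bullet> d X i \<le> 0"
          using XY(4) True i by (auto simp: out_def not_less[symmetric])
        ultimately show ?thesis by (rule mult_nonneg_nonpos)
      next
        case False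
        then have "(i \<in> Y) = (i \<in> X)"
          using XY(3) by auto
        then have "\<alpha> i (i \<in> X) \<bullet> (v Y - v X) = 0"
          using eq[OF XY(2) i, of "i \<in> X"] eq[OF XY(1) i, of "i \<in> X"] by (simp add: inner_diff_right)
        then show ?thesis by simp
      qed
    qed
    finally show ?thesis by (simp add: inner_diff_right)
  qed
  \<comment> \<open>The faces with free directions \<open>S\<close> are indexed by subsets of
    \<open>U\<close>, and each has exactly one sink: a maximum exists, and genericity makes it
    unique.\<close>
  have count: "card {X \<in> Pow {..<k}. out X \<subseteq> U} = 2 ^ card U" if U: "U \<subseteq> {..<k}" for U
  proof -
    define S where "S = {..<k} - U"
    have out_iff: "out X \<subseteq> U \<longleftrightarrow> out X \<inter> S = {}" for X
      by (auto simp: out_def S_def)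
    have "bij_betw (\<lambda>X. X - S) {X \<in> Pow {..<k}. out X \<subseteq> U} (Pow U)"
    proof (rule bij_betw_imageI)
      show "inj_on (\<lambda>X. X - S) {X \<in> Pow {..<k}. out X \<subseteq> U}"
      proof (rule inj_onI)
        fix X Y assume X: "X \<in> {X \<in> Pow {..<k}. out X \<subseteq> U}" and Y: "Y \<in> {X \<in> Pow {..<k}. out X \<subseteq> U}"
          and *: "X - S = Y - S"
        have "\<phi> \<bullet> v Y \<le> \<phi> \<bullet> v X"
          by (rule sink[of X Y S]) (use X Y * in \<open>auto simp: out_iff\<close>)
        moreover have "\<phi> \<bullet> v X \<le> \<phi> \<bullet> v Y"
          by (rule sink[of Y X S]) (use X Y * in \<open>auto simp: out_iff\<close>)
        ultimately show "X = Y"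
          using generic[of X Y] X Y by auto
      qed
      show "(\<lambda>X. X - S) ` {X \<in> Pow {..<k}. out X \<subseteq> U} = Pow U"
      proof (intro equalityI subsetI)
        fix Z assume Z: "Z \<in> Pow U"
        define \<F> where "\<F> = (\<lambda>W. Z \<union> W) ` Pow S"
        have "finite \<F>" "\<F> \<noteq> {}"
          by (auto simp: \<F>_def S_def)
        then have "Max ((\<lambda>Y. \<phi> \<bullet> v Y) ` \<F>) \<in> (\<lambda>Y. \<phi> \<bullet> v Y) ` \<F>"
          by (intro Max_in) auto
        then obtain X where "X \<in> \<F>" "Max ((\<lambda>Y. \<phi> \<bullet> v Y) ` \<F>) = \<phi> \<bullet> v X"
          by blast
        then have X: "X \<in> \<F>" "\<And>Y. Y \<in> \<F> \<Longrightarrow> \<phi> \<bullet> v Y \<le> \<phi> \<bullet> v X"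
          using \<open>finite \<F>\<close> by (auto simp flip: \<open>Max _ = _\<close>)
        have \<F>: "Y \<in> \<F> \<longleftrightarrow> Y \<subseteq> {..<k} \<and> Y - S = Z" for Y
        proof
          assume "Y \<subseteq> {..<k} \<and> Y - S = Z"
          then have "Y = Z \<union> (Y \<inter> S)" by auto
          then show "Y \<in> \<F>" unfolding \<F>_def by blast
        qed (use Z U in \<open>auto simp: \<F>_def S_def\<close>)
        have "i \<notin> out X" if "i \<in> S" for i
        proof -
          have i: "i < k" using that by (simp add: S_def)
          have X': "X \<subseteq> {..<k}" "X - S = Z" using X(1) \<F> by auto
          have "flip X i - S = X - S"
            using that by (auto simp: flip_def)
          then have "flip X i \<in> \<F>"
            using flip(1)[OF X'(1) i] X'(2) by (simp add: \<F>)
          then show ?thesis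
            using X(2)[of "flip X i"] by (simp add: out_def d_def inner_diff_right)
        qed
        then have "out X \<subseteq> U"
          by (auto simp: out_iff)
        then show "Z \<in> (\<lambda>X. X - S) ` {X \<in> Pow {..<k}. out X \<subseteq> U}"
          using X(1) \<F> by auto
      qed (auto simp: S_def)
    qed
    then show ?thesis
      using finite_subset[OF U] by (simp add: bij_betw_same_card card_Pow)
  qed
  obtain X where X: "X \<subseteq> {..<k}" "out X = T"
    using exists_outmap[of "{..<k}" out T] count T by (auto simp: out_def)
  let ?c = "\<lambda>i. (\<alpha> i (i \<in> X) \<bullet> e X) / (\<alpha> i (i \<in> X) \<bullet> d X i)"
  have "\<phi> \<bullet> e X = (\<Sum>i<k. ?c i * (\<phi> \<bullet> d X i))"
    by (subst expand[OF X(1) eD[OF X(1)]]) (simp add: inner_sum_right)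
  also have "\<dots> \<le> 0"
  proof (rule sum_nonpos)
    fix i assume "i \<in> {..<k}"
    then have i: "i < k" by simp
    show "?c i * (\<phi> \<bullet> d X i) \<le> 0"
    proof (cases "i \<in> T")
      case True
      then have "?c i \<le> 0" "\<phi> \<bullet> d X i \<ge> 0"
        using pos[OF X(1)] d_diag[OF X(1) i] X(2) by (auto simp: out_def divide_nonneg_neg less_imp_le)
      then show ?thesis by (rule mult_nonpos_nonneg)
    next
      case False
      then have "?c i \<ge> 0" "\<phi> \<bullet> d X i \<le> 0"
        using neg[OF X(1) i] d_diag[OF X(1) i] X(2) i by (auto simp: out_def divide_nonpos_neg less_imp_le not_less)
      then show ?thesis by (rule mult_nonneg_nonpos)
    qed
  qed
  finally show False
    using \<phi>[OF X(1)] by simp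
qed

section \<open>Line shellings\<close>

definition supports :: "'a::euclidean_space \<Rightarrow> real \<Rightarrow> 'a set \<Rightarrow> 'a set \<Rightarrow> bool" where
  "supports a b R F \<longleftrightarrow> (\<forall>x\<in>F. a \<bullet> x \<le> b) \<and> R = F \<inter> {x. a \<bullet> x = b}"

text \<open>In a minimal half-space description every inequality defines a facet.\<close>

lemma polyhedron_facet_representation:
  fixes F :: "'a::euclidean_space set"
  assumes "polyhedron F"
  obtains H :: "'a set set" and a b where "finite H"
    "F = affine hull F \<inter> {x. \<forall>h\<in>H. a h \<bullet> x \<le> b h}"
    "\<And>h. h \<in> H \<Longrightarrow> F \<inter> {x. a h \<bullet> x = b h} facet_of F"
proof -
  obtain H where "finite H" and seq: "F = affine hull F \<inter> \<Inter>H"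
    and faces: "\<And>h. h \<in> H \<Longrightarrow> \<exists>a b. a \<noteq> 0 \<and> h = {x. a \<bullet> x \<le> b}"
    and min: "\<And>H'. H' \<subset> H \<Longrightarrow> F \<subset> affine hull F \<inter> \<Inter>H'"
    using assms by (simp add: polyhedron_Int_affine_minimal) meson
  then obtain a b where ab: "\<And>h. h \<in> H \<Longrightarrow> a h \<noteq> 0 \<and> h = {x. a h \<bullet> x \<le> b h}"
    by metis
  have "x \<in> h \<longleftrightarrow> a h \<bullet> x \<le> b h" if "h \<in> H" for x h
    using ab[OF that] by auto
  then have "\<Inter>H = {x. \<forall>h\<in>H. a h \<bullet> x \<le> b h}"
    by blast
  with seq have "F = affine hull F \<inter> {x. \<forall>h\<in>H. a h \<bullet> x \<le> b h}"
    by simp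
  then show ?thesis
  proof (rule that[OF \<open>finite H\<close>])
    show "F \<inter> {x. a h \<bullet> x = b h} facet_of F" if "h \<in> H" for h
      using facet_of_polyhedron_explicit[OF \<open>finite H\<close> seq ab min] that by auto
  qed
qed

lemma affine_hull_insert_facet:
  assumes "R facet_of F" "q \<in> affine hull F" "q \<notin> affine hull R"
  shows "affine hull (insert q R) = affine hull F"
proof -
  have "insert q R \<subseteq> affine hull F"
    using assms hull_subset[of F affine] facet_of_imp_subset by blast
  moreover have "aff_dim (insert q R) = aff_dim (affine hull F)"
    using assms by (simp add: aff_dim_insert facet_of_def)
  ultimately show ?thesis
    using aff_dim_eq_full_gen[of "insert q R" "affine hull F"] by (simp add: hull_hull)
qed

lemma supports_strict_point:
  assumes "R facet_of F" "supports a b R F"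
  obtains q where "q \<in> F" "a \<bullet> q < b" "q \<notin> affine hull R"
proof -
  have "R \<subseteq> F" "R \<noteq> F"
    using assms facet_of_imp_subset facet_of_irrefl by blast+
  then obtain q where q: "q \<in> F" "q \<notin> R" by blast
  then have "a \<bullet> q < b"
    using assms(2) by (auto simp: supports_def order_less_le)
  moreover have "affine hull R \<subseteq> {x. a \<bullet> x = b}"
    using assms(2) by (intro hull_minimal affine_hyperplane) (auto simp: supports_def)
  ultimately show ?thesis
    using that q(1) by auto
qed

text \<open>Both slack functions vanish on \<open>R\<close>, and \<open>R\<close> with one further
  point \<open>q\<close> of \<open>F\<close> spans the affine hull; \<open>c\<close> is the ratio of
  the slacks at \<open>q\<close>. Signs thus do not depend on the chosen normal.\<close>

lemma supports_proportional:
  assumes R: "R facet_of F" and s: "supports a b R F" "supports a' b' R F"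
  shows "\<exists>c>0. \<forall>x\<in>affine hull F. b - a \<bullet> x = c * (b' - a' \<bullet> x)"
proof -
  obtain q where q: "q \<in> F" "a \<bullet> q < b" "q \<notin> affine hull R"
    using supports_strict_point[OF R s(1)] .
  have "q \<notin> R"
    using q(3) hull_inc by metis
  then have q': "a' \<bullet> q < b'"
    using s(2) q(1) by (auto simp: supports_def order_less_le)
  define c where "c = (b - a \<bullet> q) / (b' - a' \<bullet> q)"
  have "c > 0"
    using q(2) q' by (simp add: c_def)
  have eq: "{x. b - a \<bullet> x = c * (b' - a' \<bullet> x)} = {x. (a - c *\<^sub>R a') \<bullet> x = b - c * b'}"
    by (auto simp: inner_diff_left algebra_simps)
  have "affine hull (insert q R) \<subseteq> {x. (a - c *\<^sub>R a') \<bullet> x = b - c * b'}"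
  proof (intro hull_minimal affine_hyperplane)
    have "q \<in> {x. b - a \<bullet> x = c * (b' - a' \<bullet> x)}"
      using q' by (simp add: c_def)
    moreover have "R \<subseteq> {x. b - a \<bullet> x = c * (b' - a' \<bullet> x)}"
      using s by (auto simp: supports_def)
    ultimately show "insert q R \<subseteq> {x. (a - c *\<^sub>R a') \<bullet> x = b - c * b'}"
      unfolding eq by blast
  qed
  moreover have "affine hull (insert q R) = affine hull F"
    using affine_hull_insert_facet[OF R hull_inc[OF q(1)] q(3)] .
  ultimately show ?thesis
    using \<open>c > 0\<close> eq by blast
qed

lemma supports_affine_hull:
  assumes R: "R facet_of F" and s: "supports a b R F" and x: "x \<in> affine hull F" "a \<bullet> x = b"
  shows "x \<in> affine hull R"
proof (rule ccontr)
  assume "x \<notin> affine hull R"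
  then have "affine hull (insert x R) = affine hull F"
    using affine_hull_insert_facet[OF R x(1)] by blast
  moreover have "affine hull (insert x R) \<subseteq> {y. a \<bullet> y = b}"
    using s x(2) by (intro hull_minimal affine_hyperplane) (auto simp: supports_def)
  moreover obtain q where "q \<in> F" "a \<bullet> q < b"
    using supports_strict_point[OF R s] .
  ultimately show False
    using hull_inc[of q F affine] by auto
qed

text \<open>If no facet through \<open>x\<close> were left in direction \<open>e\<close>, a short
  step along \<open>e\<close> would stay in \<open>F\<close>, contradicting the valid inequality
  given by \<alpha>.\<close>

lemma exit_facet:
  assumes F: "polyhedron F" and x: "x \<in> F" "x + e \<in> affine hull F"
    and \<alpha>: "\<And>y. y \<in> F \<Longrightarrow> \<alpha> \<bullet> y \<le> \<beta>" "\<alpha> \<bullet> x = \<beta>" "\<alpha> \<bullet> e > 0"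
  obtains R where "R facet_of F" "x \<in> R" "\<And>a b. supports a b R F \<Longrightarrow> a \<bullet> e > 0"
proof -
  obtain H :: "'a set set" and a b where H: "finite H" "F = affine hull F \<inter> {x. \<forall>h\<in>H. a h \<bullet> x \<le> b h}"
    "\<And>h. h \<in> H \<Longrightarrow> F \<inter> {x. a h \<bullet> x = b h} facet_of F"
    using polyhedron_facet_representation[OF F] by blast
  have le: "a h \<bullet> y \<le> b h" if "h \<in> H" "y \<in> F" for h y
    using H(2) that by blast
  have "\<exists>h\<in>H. a h \<bullet> x = b h \<and> a h \<bullet> e > 0"
  proof (rule ccontr)
    assume contra: "\<not> ?thesis"
    have "eventually (\<lambda>t. a h \<bullet> (x + t *\<^sub>R e) \<le> b h) (at_right 0)" if "h \<in> H" for h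
    proof (cases "a h \<bullet> x = b h")
      case True
      then have "a h \<bullet> e \<le> 0"
        using contra that by auto
      moreover have "eventually (\<lambda>t::real. 0 < t) (at_right 0)"
        by (rule eventually_at_right_less)
      ultimately show ?thesis
        by (auto elim!: eventually_mono simp: True inner_add_right mult_nonneg_nonpos)
    next
      case False
      then have "a h \<bullet> (x + 0 *\<^sub>R e) < b h"
        using le[OF that x(1)] by simp
      moreover have "((\<lambda>t. a h \<bullet> (x + t *\<^sub>R e)) \<longlongrightarrow> a h \<bullet> (x + 0 *\<^sub>R e)) (at_right 0)"
        by (intro tendsto_intros)
      ultimately have "eventually (\<lambda>t. a h \<bullet> (x + t *\<^sub>R e) < b h) (at_right 0)"
        by (intro order_tendstoD(2))
      then show ?thesis
        by (rule eventually_mono) simp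
    qed
    then have "eventually (\<lambda>t. \<forall>h\<in>H. a h \<bullet> (x + t *\<^sub>R e) \<le> b h) (at_right 0)"
      using H(1) by (intro eventually_ball_finite) auto
    moreover have "eventually (\<lambda>t::real. 0 < t) (at_right 0)"
      by (rule eventually_at_right_less)
    ultimately have "eventually (\<lambda>t. 0 < t \<and> (\<forall>h\<in>H. a h \<bullet> (x + t *\<^sub>R e) \<le> b h)) (at_right 0)"
      by eventually_elim simp
    then obtain t where t: "0 < t" "\<forall>h\<in>H. a h \<bullet> (x + t *\<^sub>R e) \<le> b h"
      using eventually_happens trivial_limit_at_right_real by blast
    have "(1 - t) *\<^sub>R x + t *\<^sub>R (x + e) \<in> affine hull F"
      by (rule mem_affine[OF affine_affine_hull hull_inc[OF x(1)] x(2)]) simp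
    moreover have "(1 - t) *\<^sub>R x + t *\<^sub>R (x + e) = x + t *\<^sub>R e"
      by (simp add: algebra_simps)
    ultimately have "x + t *\<^sub>R e \<in> F"
      using H(2) t(2) by auto
    then have "\<alpha> \<bullet> (x + t *\<^sub>R e) \<le> \<beta>"
      by (rule \<alpha>(1))
    then have "t * (\<alpha> \<bullet> e) \<le> 0"
      by (simp add: inner_add_right \<alpha>(2))
    then show False
      using mult_pos_pos[OF t(1) \<alpha>(3)] by linarith
  qed
  then obtain h where h: "h \<in> H" "a h \<bullet> x = b h" "a h \<bullet> e > 0"
    by blast
  define R where "R = F \<inter> {x. a h \<bullet> x = b h}"
  have R: "R facet_of F" "x \<in> R" "supports (a h) (b h) R F"
    using H(3)[OF h(1)] x(1) h le by (auto simp: R_def supports_def)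
  have "a' \<bullet> e > 0" if s: "supports a' b' R F" for a' b'
  proof -
    obtain c where c: "c > 0" "\<forall>x\<in>affine hull F. b' - a' \<bullet> x = c * (b h - a h \<bullet> x)"
      using supports_proportional[OF R(1) s R(3)] by blast
    have "b' - a' \<bullet> x = c * (b h - a h \<bullet> x)" "b' - a' \<bullet> (x + e) = c * (b h - a h \<bullet> (x + e))"
      using c(2) x(2) hull_inc[OF x(1)] by blast+
    then have "a' \<bullet> e = c * (a h \<bullet> e)"
      by (simp add: inner_add_right algebra_simps)
    then show ?thesis
      using c(1) h(3) by simp
  qed
  then show ?thesis
    using that R by blast
qed

lemma facet_eq_of_subset:
  assumes "polytope P" "F facet_of P" "F' facet_of P" "F \<subseteq> F'"
  shows "F = F'"
proof (rule ccontr)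
  assume "F \<noteq> F'"
  have "F face_of F'"
    using face_of_subset[OF facet_of_imp_face_of[OF assms(2)] assms(4) facet_of_imp_subset[OF assms(3)]] .
  moreover have "convex F'"
    using assms(3) facet_of_imp_face_of face_of_imp_convex by blast
  ultimately have "aff_dim F < aff_dim F'"
    using face_of_aff_dim_lt \<open>F \<noteq> F'\<close> by blast
  then show False
    using assms(2,3) by (simp add: facet_of_def)
qed

text \<open>\<open>R\<close> is the intersection of the facets of \<open>P\<close> containing it, so
  one of them differs from \<open>F\<close>. It meets \<open>F\<close> in a proper face containing
  \<open>R\<close>, and dimensions force equality.\<close>

lemma facet_of_facet:
  assumes P: "polytope P" and F: "F facet_of P" and R: "R facet_of F"
  shows "\<exists>F'. F' facet_of P \<and> F' \<noteq> F \<and> R = F \<inter> F'"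
proof -
  have RP: "R face_of P" "R \<noteq> {}" "R \<noteq> P" "R \<subseteq> F" "R \<noteq> F"
    using F R face_of_trans[OF facet_of_imp_face_of[OF R] facet_of_imp_face_of[OF F]]
      facet_of_imp_subset[OF R] by (auto simp: facet_of_def)
  have "R = \<Inter>{F'. F' facet_of P \<and> R \<subseteq> F'}"
    using face_of_polyhedron[OF polytope_imp_polyhedron[OF P] RP(1-3)] .
  then obtain F' where F': "F' facet_of P" "R \<subseteq> F'" "F' \<noteq> F"
    using RP(4,5) by (metis (no_types, lifting) Inf_greatest mem_Collect_eq order_refl subset_antisym)
  have face: "F \<inter> F' face_of F"
    using face_of_subset[OF face_of_Int[OF facet_of_imp_face_of[OF F] facet_of_imp_face_of[OF F'(1)]]]
      facet_of_imp_subset[OF F] by blast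
  have convex: "convex F" "convex (F \<inter> F')"
    using F face facet_of_imp_face_of face_of_imp_convex by blast+
  have "F \<inter> F' \<noteq> F"
    using facet_eq_of_subset[OF P F F'(1)] F'(3) by blast
  then have lt: "aff_dim (F \<inter> F') < aff_dim F"
    using face_of_aff_dim_lt[OF convex(1) face] by blast
  have "R = F \<inter> F'"
  proof (rule ccontr)
    assume "R \<noteq> F \<inter> F'"
    moreover have "R face_of F \<inter> F'"
      by (rule face_of_subset[OF facet_of_imp_face_of[OF R]]) (use RP F' in auto)
    ultimately have "aff_dim R < aff_dim (F \<inter> F')"
      using face_of_aff_dim_lt[OF convex(2)] by blast
    then show False
      using lt R by (simp add: facet_of_def)
  qed
  then show ?thesis
    using F' by blast
qed

text \<open>A single facet would contain all vertices, hence all of \<open>P\<close>.\<close>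

lemma exists_two_facets:
  assumes P: "polytope P" "aff_dim P > 0"
  obtains F F' where "F facet_of P" "F' facet_of P" "F \<noteq> F'"
proof -
  obtain F where F: "F facet_of P"
    using polytope_facet_exists[OF P] .
  have "\<exists>F'. F' facet_of P \<and> F' \<noteq> F"
  proof (rule ccontr)
    assume contra: "\<not> ?thesis"
    have "v \<in> F" if "v extreme_point_of P" for v
    proof -
      have "{v} face_of P"
        using that by (simp add: face_of_singleton)
      moreover have "{v} \<noteq> P"
        using P(2) by auto
      ultimately obtain F' where "F' facet_of P" "{v} \<subseteq> F'"
        using face_of_polyhedron_subset_facet[OF polytope_imp_polyhedron[OF P(1)]] by blast
      then show ?thesis
        using contra by auto
    qed
    moreover have "P = convex hull {v. v extreme_point_of P}"
      using Krein_Milman_Minkowski[OF polytope_imp_compact[OF P(1)] polytope_imp_convex[OF P(1)]] .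
    moreover have "convex F"
      using F facet_of_imp_face_of face_of_imp_convex by blast
    ultimately have "P \<subseteq> F"
      by (metis hull_minimal mem_Collect_eq subsetI)
    then have "F = P"
      using facet_of_imp_subset[OF F] by blast
    then show False
      using F by simp
  qed
  then show ?thesis
    using F that by blast
qed

section \<open>Sweeping the facets of a polytope along a generic line\<close>

locale sweep =
  fixes P :: "'a::euclidean_space set" and \<alpha> :: "'a set \<Rightarrow> 'a" and \<beta> :: "'a set \<Rightarrow> real" and p u :: 'a
  assumes polytope: "polytope P"
    and facet: "\<And>F. F facet_of P \<Longrightarrow> supports (\<alpha> F) (\<beta> F) F P"
    and p: "p \<in> rel_interior P"
    and u: "p + u \<in> affine hull P"
    and inj: "inj_on (\<lambda>F. (\<alpha> F \<bullet> u) / (\<beta> F - \<alpha> F \<bullet> p)) {F. F facet_of P}"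
begin

text \<open>The reciprocal of the line parameter at the hyperplane of \<open>F\<close>. Decreasing
  \<open>w\<close> is the shelling order: outwards from \<open>p\<close> along \<open>u\<close>,
  through infinity, and back from the other side.\<close>

definition w :: "'a set \<Rightarrow> real" where
  "w F = (\<alpha> F \<bullet> u) / (\<beta> F - \<alpha> F \<bullet> p)"

text \<open>If \<open>w F \<noteq> 0\<close>, then \<open>p + (1 / w F) *\<^sub>R u\<close> is the point where the sweep line meets the affine hull of
  \<open>F\<close>, and \<open>escape F x\<close> is \<open>w F\<close> times the vector from \<open>x\<close> to it. This scaling covers both sides of the
  line and the parallel case \<open>w F = 0\<close> at once: the facets through \<open>x\<close> earlier than \<open>F\<close> are those left
  in this direction.\<close>

definition escape :: "'a set \<Rightarrow> 'a \<Rightarrow> 'a" where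
  "escape F x = u + w F *\<^sub>R (p - x)"

definition neighbour :: "'a set \<Rightarrow> 'a set \<Rightarrow> 'a set" where
  "neighbour F R = (SOME F'. F' facet_of P \<and> F' \<noteq> F \<and> R = F \<inter> F')"

text \<open>These are the facets of \<open>F\<close> along which the shelling attaches it to its
  predecessors.\<close>

definition early :: "'a set \<Rightarrow> 'a set set" where
  "early F = {R. R facet_of F \<and> w (neighbour F R) > w F}"

lemma neighbour:
  assumes "F facet_of P" "R facet_of F"
  shows "neighbour F R facet_of P" "neighbour F R \<noteq> F" "R = F \<inter> neighbour F R"
  using someI_ex[OF facet_of_facet[OF polytope assms]] by (auto simp: neighbour_def)

lemma supports_neighbour:
  assumes "F facet_of P" "R facet_of F"
  shows "supports (\<alpha> (neighbour F R)) (\<beta> (neighbour F R)) R F"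
  using facet[OF neighbour(1)[OF assms]] neighbour(3)[OF assms] facet_of_imp_subset[OF assms(1)]
  unfolding supports_def by blast

lemma w_eq_iff: "F facet_of P \<Longrightarrow> F' facet_of P \<Longrightarrow> w F = w F' \<longleftrightarrow> F = F'"
  using inj by (auto simp: inj_on_def w_def)

lemma slack_pos:
  assumes "F facet_of P"
  shows "\<beta> F - \<alpha> F \<bullet> p > 0"
proof -
  have "p \<in> P"
    using p rel_interior_subset by blast
  moreover have "p \<notin> F"
    using face_of_disjoint_rel_interior[OF facet_of_imp_face_of[OF assms]] assms facet_of_irrefl p by blast
  ultimately show ?thesis
    using facet[OF assms] by (auto simp: supports_def order_less_le)
qed

text \<open>On \<open>F'\<close> the last term vanishes, and since the slack at \<open>p\<close> is
  positive the sign tells whether \<open>F'\<close> precedes \<open>F\<close>.\<close>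

lemma inner_escape:
  assumes "F' facet_of P"
  shows "\<alpha> F' \<bullet> escape F x = (\<beta> F' - \<alpha> F' \<bullet> p) * (w F' - w F) + w F * (\<beta> F' - \<alpha> F' \<bullet> x)"
proof -
  have "\<alpha> F' \<bullet> u = (\<beta> F' - \<alpha> F' \<bullet> p) * w F'"
    using slack_pos[OF assms] by (simp add: w_def)
  then show ?thesis
    by (simp add: escape_def inner_add_right inner_diff_right algebra_simps)
qed

lemma inner_escape_facet:
  assumes "F' facet_of P" "x \<in> F'"
  shows "\<alpha> F' \<bullet> escape F x = (\<beta> F' - \<alpha> F' \<bullet> p) * (w F' - w F)"
proof -
  have "\<alpha> F' \<bullet> x = \<beta> F'"
    using facet[OF assms(1)] assms(2) by (auto simp: supports_def)
  then show ?thesis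
    using inner_escape[OF assms(1), of F x] by simp
qed

lemma escape_affine:
  assumes F: "F facet_of P" and x: "x \<in> F"
  shows "x + escape F x \<in> affine hull F"
proof (rule supports_affine_hull[OF F facet[OF F]])
  have "p \<in> affine hull P" "x \<in> affine hull P"
    using p rel_interior_subset x facet_of_imp_subset[OF F] by (auto intro: hull_inc)
  then have "(1 - w F) *\<^sub>R x + (w F - 1) *\<^sub>R p + 1 *\<^sub>R (p + u) \<in> affine hull P"
    using u by (intro mem_affine_3 affine_affine_hull) auto
  moreover have "(1 - w F) *\<^sub>R x + (w F - 1) *\<^sub>R p + 1 *\<^sub>R (p + u) = x + escape F x"
    by (simp add: escape_def algebra_simps)
  ultimately show "x + escape F x \<in> affine hull P"
    by simp
  have "\<alpha> F \<bullet> x = \<beta> F"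
    using facet[OF F] x by (auto simp: supports_def)
  then show "\<alpha> F \<bullet> (x + escape F x) = \<beta> F"
    using inner_escape_facet[OF F x, of F] by (simp add: inner_add_right)
qed

text \<open>The shelling property. At a relative interior point of \<open>K\<close> the escape
  direction leaves the earlier facet, so by \<open>exit_facet\<close> it leaves a facet
  \<open>R\<close> of \<open>F\<close> through that point; the neighbour across \<open>R\<close> is
  then earlier, and \<open>R\<close> contains \<open>K\<close>.\<close>

lemma subset_earlier_facet_iff:
  assumes F: "F facet_of P" and K: "K face_of F" "K \<noteq> {}"
  shows "(\<exists>F'. F' facet_of P \<and> w F' > w F \<and> K \<subseteq> F') \<longleftrightarrow> (\<exists>R\<in>early F. K \<subseteq> R)"
proof
  assume "\<exists>R\<in>early F. K \<subseteq> R"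
  then obtain R where R: "R facet_of F" "w (neighbour F R) > w F" "K \<subseteq> R"
    by (auto simp: early_def)
  then show "\<exists>F'. F' facet_of P \<and> w F' > w F \<and> K \<subseteq> F'"
    using neighbour[OF F R(1)] by blast
next
  assume "\<exists>F'. F' facet_of P \<and> w F' > w F \<and> K \<subseteq> F'"
  then obtain F' where F': "F' facet_of P" "w F' > w F" "K \<subseteq> F'"
    by blast
  obtain x where x: "x \<in> rel_interior K"
    using K rel_interior_eq_empty face_of_imp_convex by blast
  have "x \<in> K" using x rel_interior_subset by blast
  then have xF: "x \<in> F" "x \<in> F'"
    using face_of_imp_subset[OF K(1)] F'(3) by auto
  have polyF: "polytope F"
    using face_of_polytope_polytope[OF polytope facet_of_imp_face_of[OF F]] .
  have "\<alpha> F' \<bullet> y \<le> \<beta> F'" if "y \<in> F" for y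
    using facet[OF F'(1)] facet_of_imp_subset[OF F] that by (auto simp: supports_def)
  moreover have "\<alpha> F' \<bullet> x = \<beta> F'"
    using facet[OF F'(1)] xF(2) by (auto simp: supports_def)
  moreover have "\<alpha> F' \<bullet> escape F x > 0"
    using inner_escape_facet[OF F'(1) xF(2), of F] slack_pos[OF F'(1)] F'(2) by simp
  ultimately obtain R where R: "R facet_of F" "x \<in> R" "\<And>a b. supports a b R F \<Longrightarrow> a \<bullet> escape F x > 0"
    using exit_facet[OF polytope_imp_polyhedron[OF polyF] xF(1) escape_affine[OF F xF(1)]] by blast
  have "x \<in> neighbour F R"
    using R(2) neighbour(3)[OF F R(1)] by blast
  then have "(\<beta> (neighbour F R) - \<alpha> (neighbour F R) \<bullet> p) * (w (neighbour F R) - w F) > 0"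
    using R(3)[OF supports_neighbour[OF F R(1)]] inner_escape_facet[OF neighbour(1)[OF F R(1)]] by simp
  then have "R \<in> early F"
    using slack_pos[OF neighbour(1)[OF F R(1)]] R(1) by (simp add: early_def zero_less_mult_iff)
  moreover have "K \<subseteq> R"
    using subset_of_face_of[OF facet_of_imp_face_of[OF R(1)] face_of_imp_subset[OF K(1)]] x R(2) by blast
  ultimately show "\<exists>R\<in>early F. K \<subseteq> R" by blast
qed

text \<open>If it vanished, the nonnegative slacks of \<open>x\<close> at an earlier and at a later
  facet would force \<open>w F\<close> to be both negative and positive.\<close>

lemma escape_nonzero:
  assumes F: "F facet_of P" and x: "x \<in> F"
    and F1: "F1 facet_of P" "w F1 > w F" and F2: "F2 facet_of P" "w F2 < w F"
  shows "escape F x \<noteq> 0"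
proof
  assume 0: "escape F x = 0"
  have slack: "\<beta> F' - \<alpha> F' \<bullet> x \<ge> 0" if "F' facet_of P" for F'
    using facet[OF that] facet_of_imp_subset[OF F] x by (auto simp: supports_def)
  have "0 < (\<beta> F1 - \<alpha> F1 \<bullet> p) * (w F1 - w F)" "(\<beta> F2 - \<alpha> F2 \<bullet> p) * (w F2 - w F) < 0"
    using slack_pos F1 F2 by (simp_all add: mult_pos_neg)
  moreover have "0 = (\<beta> F1 - \<alpha> F1 \<bullet> p) * (w F1 - w F) + w F * (\<beta> F1 - \<alpha> F1 \<bullet> x)"
    "0 = (\<beta> F2 - \<alpha> F2 \<bullet> p) * (w F2 - w F) + w F * (\<beta> F2 - \<alpha> F2 \<bullet> x)"
    using inner_escape[OF F1(1), of F x] inner_escape[OF F2(1), of F x] 0 by simp_all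
  ultimately have "w F * (\<beta> F1 - \<alpha> F1 \<bullet> x) < 0" "w F * (\<beta> F2 - \<alpha> F2 \<bullet> x) > 0"
    by linarith+
  then show False
    using slack[OF F1(1)] slack[OF F2(1)] by (auto simp: zero_less_mult_iff mult_less_0_iff)
qed

text \<open>If opposite facets were always both early or both not, the escape vectors at all
  vertices would show one sign pattern \<open>T\<close>, which
  \<open>cube_sign_contradiction\<close> excludes.\<close>

lemma unbalanced_pair_exists:
  assumes F: "F facet_of P" and F1: "F1 facet_of P" "w F1 > w F" and F2: "F2 facet_of P" "w F2 < w F"
    and cube: "labelled_cube F k \<psi>"
  shows "\<exists>i<k. (\<psi> [i \<mapsto> True] \<in> early F) \<noteq> (\<psi> [i \<mapsto> False] \<in> early F)"
proof (rule ccontr)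
  assume "\<not> ?thesis"
  then have same: "\<psi> [i \<mapsto> b] \<in> early F \<longleftrightarrow> \<psi> [i \<mapsto> True] \<in> early F" if "i < k" for i b
    using that by (cases b) auto
  interpret cube: labelled_cube F k \<psi> by (rule cube)
  define D where "D = span ((+) (- cube.vertex {}) ` F)"
  have hull: "affine hull F = (+) (cube.vertex {}) ` D"
    unfolding D_def by (rule affine_hull_span_gen) (rule hull_inc[OF cube.vertex_in])
  have dimD: "dim D = k"
    using aff_dim_eq_dim[OF hull_inc[OF cube.vertex_in[of "{}"]]] cube.aff_dim_eq by (simp add: D_def)
  have diffD: "x - y \<in> D" if "x \<in> affine hull F" "y \<in> affine hull F" for x y
  proof -
    obtain d d' where "d \<in> D" "d' \<in> D" "x = cube.vertex {} + d" "y = cube.vertex {} + d'"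
      using \<open>x \<in> affine hull F\<close> \<open>y \<in> affine hull F\<close> unfolding hull by blast
    then show ?thesis
      by (simp add: D_def span_diff)
  qed
  define e where "e X = escape F (cube.vertex X)" for X
  define R where "R i b = \<psi> [i \<mapsto> b]" for i b
  have R: "R i b facet_of F" if "i < k" for i b
    using that by (auto simp: cube.facet_iff R_def)
  have vR: "cube.vertex X \<in> R i b \<longleftrightarrow> b = (i \<in> X)" if "i < k" for X i b
    unfolding R_def by (rule cube.vertex_in_facet_iff[OF that])
  define T where "T = {i\<in>{..<k}. \<psi> [i \<mapsto> True] \<in> early F}"
  have sign: "\<alpha> (neighbour F (R i (i \<in> X))) \<bullet> e X
      = (\<beta> (neighbour F (R i (i \<in> X))) - \<alpha> (neighbour F (R i (i \<in> X))) \<bullet> p) * (w (neighbour F (R i (i \<in> X))) - w F)"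
    if "i < k" for i X
  proof -
    have "cube.vertex X \<in> neighbour F (R i (i \<in> X))"
      using vR[OF that, of X "i \<in> X"] neighbour(3)[OF F R[OF that]] by blast
    then show ?thesis
      unfolding e_def by (rule inner_escape_facet[OF neighbour(1)[OF F R[OF that]]])
  qed
  have early_iff: "R i b \<in> early F \<longleftrightarrow> w (neighbour F (R i b)) > w F" if "i < k" for i b
    using R[OF that] by (simp add: early_def)
  \<comment> \<open>The escape vectors of points of \<open>F\<close> form a compact convex set
    missing 0, so some functional is positive on all of them.\<close>
  let ?S = "(\<lambda>x. (u + w F *\<^sub>R p) + (- w F) *\<^sub>R x) ` F"
  have polyF: "polytope F"
    using face_of_polytope_polytope[OF polytope facet_of_imp_face_of[OF F]] .
  have escape_eq: "escape F x = (u + w F *\<^sub>R p) + (- w F) *\<^sub>R x" for x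
    by (simp add: escape_def algebra_simps)
  have "convex ?S" "closed ?S"
    using convex_affinity[OF polytope_imp_convex[OF polyF]]
      compact_imp_closed[OF compact_affinity[OF polytope_imp_compact[OF polyF]]] by blast+
  moreover have "0 \<notin> ?S"
    using escape_nonzero[OF F _ F1 F2] by (auto simp: escape_eq)
  ultimately obtain \<phi>\<^sub>0 b where "0 < b" "\<forall>y\<in>?S. \<phi>\<^sub>0 \<bullet> y > b"
    using separating_hyperplane_closed_0 by blast
  then have \<phi>\<^sub>0: "\<phi>\<^sub>0 \<bullet> e X > 0" for X
    using cube.vertex_in[of X] by (force simp: e_def escape_eq)
  have vertex_eq_iff: "cube.vertex X = cube.vertex Y \<longleftrightarrow> X = Y" if "X \<subseteq> {..<k}" "Y \<subseteq> {..<k}" for X Y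
  proof
    assume eq: "cube.vertex X = cube.vertex Y"
    have "i \<in> X \<longleftrightarrow> i \<in> Y" for i
    proof (cases "i < k")
      case True
      then show ?thesis using vR[OF True, of X "i \<in> Y"] vR[OF True, of Y "i \<in> Y"] eq by simp
    qed (use that in auto)
    then show "X = Y" by blast
  qed simp
  \<comment> \<open>The functional is perturbed to separate the vertices while remaining positive on
    their escape vectors.\<close>
  let ?C = "(\<lambda>(X, Y). cube.vertex X - cube.vertex Y) ` {(X, Y). X \<subseteq> {..<k} \<and> Y \<subseteq> {..<k} \<and> X \<noteq> Y}"
  have "finite {(X, Y). X \<subseteq> {..<k} \<and> Y \<subseteq> {..<k} \<and> X \<noteq> Y}"
    by (rule finite_subset[of _ "Pow {..<k} \<times> Pow {..<k}"]) auto
  then have "\<exists>\<phi>\<in>UNIV. (\<forall>y\<in>e ` Pow {..<k}. \<phi> \<bullet> y > 0) \<and> (\<forall>c\<in>?C. c \<bullet> \<phi> \<noteq> 0)"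
  proof (intro generic_direction[where \<phi>\<^sub>0 = \<phi>\<^sub>0])
    show "\<exists>d\<in>UNIV. c \<bullet> d \<noteq> 0" if "c \<in> ?C" for c
    proof -
      have "c \<noteq> 0"
        using that vertex_eq_iff by auto
      then have "c \<bullet> c \<noteq> 0" by simp
      then show ?thesis by blast
    qed
  qed (use \<phi>\<^sub>0 in auto)
  then obtain \<phi> where \<phi>': "\<forall>y\<in>e ` Pow {..<k}. \<phi> \<bullet> y > 0" "\<forall>c\<in>?C. c \<bullet> \<phi> \<noteq> 0"
    by blast
  have \<phi>: "\<phi> \<bullet> e X > 0" if "X \<subseteq> {..<k}" for X
    using \<phi>'(1) that by simp
  have generic: "(cube.vertex X - cube.vertex Y) \<bullet> \<phi> \<noteq> 0" if "X \<subseteq> {..<k}" "Y \<subseteq> {..<k}" "X \<noteq> Y" for X Y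
    using \<phi>'(2) that by auto
  show False
  proof (rule cube_sign_contradiction[where D = D and k = k and v = cube.vertex and T = T and e = e and \<phi> = \<phi>
        and \<alpha> = "\<lambda>i b. \<alpha> (neighbour F (R i b))" and \<beta> = "\<lambda>i b. \<beta> (neighbour F (R i b))"])
    show "dim D = k" by (rule dimD)
    show "cube.vertex X - cube.vertex Y \<in> D" for X Y
      by (intro diffD hull_inc cube.vertex_in)
    show "T \<subseteq> {..<k}" by (auto simp: T_def)
    show "e X \<in> D" for X
    proof -
      have "cube.vertex X + e X - cube.vertex X \<in> D"
        unfolding e_def by (intro diffD escape_affine[OF F] hull_inc cube.vertex_in)
      then show ?thesis by simp
    qed
    show "\<alpha> (neighbour F (R i b)) \<bullet> cube.vertex X \<le> \<beta> (neighbour F (R i b))" if "i < k" for X i b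
      using supports_neighbour[OF F R[OF that]] cube.vertex_in[of X] by (auto simp: supports_def)
    show "\<alpha> (neighbour F (R i b)) \<bullet> cube.vertex X = \<beta> (neighbour F (R i b)) \<longleftrightarrow> b = (i \<in> X)" if "i < k" for X i b
      using supports_neighbour[OF F R[OF that]] cube.vertex_in[of X] vR[OF that, of X b]
      unfolding supports_def by blast
    show "\<alpha> (neighbour F (R i (i \<in> X))) \<bullet> e X > 0" if "i \<in> T" for X i
    proof -
      have i: "i < k" using that by (simp add: T_def)
      then have "R i (i \<in> X) \<in> early F"
        using that same[OF i, of "i \<in> X"] by (simp add: T_def R_def)
      then show ?thesis
        unfolding sign[OF i] using early_iff[OF i] slack_pos[OF neighbour(1)[OF F R[OF i]]] by simp
    qed
    show "\<alpha> (neighbour F (R i (i \<in> X))) \<bullet> e X < 0" if i: "i < k" and "i \<notin> T" for X i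
    proof -
      have "R i (i \<in> X) \<notin> early F"
        using that same[OF i, of "i \<in> X"] by (simp add: T_def R_def)
      moreover have "w (neighbour F (R i (i \<in> X))) \<noteq> w F"
        using w_eq_iff[OF neighbour(1)[OF F R[OF i]] F] neighbour(2)[OF F R[OF i]] by simp
      ultimately have "w (neighbour F (R i (i \<in> X))) < w F"
        using early_iff[OF i, of "i \<in> X"] by linarith
      then show ?thesis
        unfolding sign[OF i] using slack_pos[OF neighbour(1)[OF F R[OF i]]] by (simp add: mult_pos_neg)
    qed
    show "\<phi> \<bullet> cube.vertex X \<noteq> \<phi> \<bullet> cube.vertex Y" if "X \<subseteq> {..<k}" "Y \<subseteq> {..<k}" "X \<noteq> Y" for X Y
      using generic[OF that] by (simp add: inner_diff_right inner_commute[of _ \<phi>])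
  qed (use \<phi> in auto)
qed

end

text \<open>A direction chosen generically in the linear space parallel to the affine hull of
  \<open>P\<close> gives distinct facets distinct values of \<open>w\<close>.\<close>

lemma sweep_exists:
  assumes P: "polytope P" "P \<noteq> {}"
  obtains \<alpha> \<beta> p u where "sweep P \<alpha> \<beta> p u"
proof -
  have "\<exists>a b. supports a b F P" if "F facet_of P" for F
    using facet_of_polyhedron[OF polytope_imp_polyhedron[OF P(1)] that]
    unfolding supports_def by (metis mem_Collect_eq subsetD)
  then obtain \<alpha> \<beta> where \<alpha>: "\<And>F. F facet_of P \<Longrightarrow> supports (\<alpha> F) (\<beta> F) F P"
    by metis
  obtain p where p: "p \<in> rel_interior P"
    using rel_interior_eq_empty[OF polytope_imp_convex[OF P(1)]] P(2) by blast
  have pP: "p \<in> P"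
    using p rel_interior_subset by blast
  define s where "s F = \<beta> F - \<alpha> F \<bullet> p" for F
  have s: "s F > 0" if "F facet_of P" for F
  proof -
    have "p \<notin> F"
      using face_of_disjoint_rel_interior[OF facet_of_imp_face_of[OF that]] that facet_of_irrefl p by blast
    then show ?thesis
      using \<alpha>[OF that] pP by (auto simp: supports_def s_def order_less_le)
  qed
  \<comment> \<open>The inner product of \<open>c F F'\<close> with \<open>u\<close> is the
    difference of the two sweep values. If it vanished for all directions in \<open>D\<close>, one
    facet would contain the other.\<close>
  define c where "c F F' = (1 / s F) *\<^sub>R \<alpha> F - (1 / s F') *\<^sub>R \<alpha> F'" for F F'
  define D where "D = span ((+) (- p) ` P)"
  have hull: "affine hull P = (+) p ` D"
    unfolding D_def by (rule affine_hull_span_gen) (rule hull_inc[OF pP])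
  have sub: "F \<subseteq> F'" if F: "F facet_of P" "F' facet_of P" and 0: "\<forall>d\<in>D. c F F' \<bullet> d = 0" for F F'
  proof
    fix x assume x: "x \<in> F"
    then have xP: "x \<in> P" and \<alpha>x: "\<alpha> F \<bullet> x = \<beta> F"
      using \<alpha>[OF F(1)] by (auto simp: supports_def)
    then have "x - p \<in> D"
      by (auto simp: D_def intro!: span_base)
    then have "c F F' \<bullet> (x - p) = 0"
      using 0 by blast
    then have "(\<alpha> F \<bullet> (x - p)) / s F = (\<alpha> F' \<bullet> (x - p)) / s F'"
      by (simp add: c_def inner_diff_left)
    moreover have "(\<alpha> F \<bullet> (x - p)) / s F = 1"
      using \<alpha>x s[OF F(1)] by (simp add: s_def inner_diff_right)
    ultimately have "\<alpha> F' \<bullet> x = \<beta> F'"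
      using s[OF F(2)] by (simp add: s_def inner_diff_right field_simps)
    then show "x \<in> F'"
      using \<alpha>[OF F(2)] xP by (auto simp: supports_def)
  qed
  let ?\<F> = "{F. F facet_of P}"
  let ?C = "(\<lambda>(F, F'). c F F') ` {(F, F'). F \<in> ?\<F> \<and> F' \<in> ?\<F> \<and> F \<noteq> F'}"
  have "finite ?\<F>"
    using finite_polytope_facets[OF P(1)] .
  then have "finite {(F, F'). F \<in> ?\<F> \<and> F' \<in> ?\<F> \<and> F \<noteq> F'}"
    by (rule_tac finite_subset[of _ "?\<F> \<times> ?\<F>"]) auto
  then have "\<exists>u\<in>D. (\<forall>e\<in>{}. u \<bullet> e > 0) \<and> (\<forall>c\<in>?C. c \<bullet> u \<noteq> 0)"
  proof (intro generic_direction[where \<phi>\<^sub>0 = 0])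
    show "\<exists>d\<in>D. x \<bullet> d \<noteq> 0" if "x \<in> ?C" for x
    proof (rule ccontr)
      assume contra: "\<not> ?thesis"
      obtain F F' where F: "F facet_of P" "F' facet_of P" "F \<noteq> F'" "x = c F F'"
        using \<open>x \<in> ?C\<close> by auto
      then show False
        using sub[OF F(1,2)] facet_eq_of_subset[OF P(1) F(1,2)] contra by blast
    qed
  qed (auto simp: D_def span_zero)
  then obtain u where u: "u \<in> D" "\<And>F F'. F facet_of P \<Longrightarrow> F' facet_of P \<Longrightarrow> F \<noteq> F' \<Longrightarrow> c F F' \<bullet> u \<noteq> 0"
    by auto
  have "sweep P \<alpha> \<beta> p u"
  proof
    show "p + u \<in> affine hull P"
      using u(1) hull by blast
    show "inj_on (\<lambda>F. \<alpha> F \<bullet> u / (\<beta> F - \<alpha> F \<bullet> p)) ?\<F>"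
    proof (rule inj_onI, rule ccontr)
      fix F F' assume "F \<in> ?\<F>" "F' \<in> ?\<F>" "F \<noteq> F'" and
        eq: "\<alpha> F \<bullet> u / (\<beta> F - \<alpha> F \<bullet> p) = \<alpha> F' \<bullet> u / (\<beta> F' - \<alpha> F' \<bullet> p)"
      then have "c F F' \<bullet> u \<noteq> 0"
        using u(2) by simp
      then show False
        using eq by (simp add: c_def s_def inner_diff_left)
    qed
  qed (use P \<alpha> p in auto)
  then show ?thesis by (rule that)
qed

section \<open>Face numbers of cubical polytopes\<close>

lemma combinatorial_cube_imp_labelled:
  fixes Q :: "'a::euclidean_space set"
  assumes "combinatorial_cube Q"
  obtains k \<psi> where "labelled_cube Q k \<psi>"
proof -
  obtain k where "polytope Q" and equiv: "combinatorially_equivalent (faces Q) (faces (std_cube k))"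
    using assms by (auto simp: combinatorial_cube_def)
  show ?thesis
  proof (rule combinatorial_cube_labelling[OF equiv])
    fix \<psi> :: "(nat \<Rightarrow> bool option) \<Rightarrow> 'a set"
    assume "\<And>m m'. dom m \<subseteq> {..<k} \<Longrightarrow> dom m' \<subseteq> {..<k} \<Longrightarrow> \<psi> m \<subseteq> \<psi> m' \<longleftrightarrow> m' \<subseteq>\<^sub>m m"
      "\<psi> ` {m. dom m \<subseteq> {..<k}} = {K. K face_of Q \<and> K \<noteq> {}}"
    with \<open>polytope Q\<close> have "labelled_cube Q k \<psi>"
      by unfold_locales
    then show ?thesis by (rule that)
  qed
qed

text \<open>The exponents count the factors with constant term 1, 0 and 2.\<close>

lemma prod_linear_eq_powers:
  fixes c :: "nat \<Rightarrow> nat"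
  assumes "\<And>i. i < k \<Longrightarrow> c i \<le> 2"
  shows "\<exists>a b d. a + b + d = k \<and> (0 < a \<longleftrightarrow> (\<exists>i<k. c i = 1)) \<and>
    (\<Prod>i<k. [:of_nat (c i), 1:]) = ([:1, 1:] ^ a * [:0, 1:] ^ b * [:2, 1:] ^ d :: complex poly)"
  using assms
proof (induction k)
  case (Suc k)
  then obtain a b d where abd: "a + b + d = k" "0 < a \<longleftrightarrow> (\<exists>i<k. c i = 1)"
    and eq: "(\<Prod>i<k. [:of_nat (c i), 1:]) = ([:1, 1:] ^ a * [:0, 1:] ^ b * [:2, 1:] ^ d :: complex poly)"
    by auto
  have "c k \<le> 2" using Suc.prems by simp
  then consider "c k = 0" | "c k = 1" | "c k = 2" by linarith
  then show ?case
  proof cases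
    case 1
    have "(\<Prod>i<Suc k. [:of_nat (c i), 1:]) = ([:1, 1:] ^ a * [:0, 1:] ^ Suc b * [:2, 1:] ^ d :: complex poly)"
      using 1 by (simp only: prod.lessThan_Suc eq power_Suc mult_ac of_nat_0)
    then show ?thesis
      using abd 1 by (intro exI[of _ a] exI[of _ "Suc b"] exI[of _ d]) (auto simp: less_Suc_eq)
  next
    case 2
    have "(\<Prod>i<Suc k. [:of_nat (c i), 1:]) = ([:1, 1:] ^ Suc a * [:0, 1:] ^ b * [:2, 1:] ^ d :: complex poly)"
      using 2 by (simp only: prod.lessThan_Suc eq power_Suc mult_ac of_nat_1)
    then show ?thesis
      using abd 2 by (intro exI[of _ "Suc a"] exI[of _ b] exI[of _ d]) auto
  next
    case 3
    have "(\<Prod>i<Suc k. [:of_nat (c i), 1:]) = ([:1, 1:] ^ a * [:0, 1:] ^ b * [:2, 1:] ^ Suc d :: complex poly)"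
      using 3 by (simp only: prod.lessThan_Suc eq power_Suc mult_ac of_nat_numeral)
    then show ?thesis
      using abd 3 by (intro exI[of _ a] exI[of _ b] exI[of _ "Suc d"]) (auto simp: less_Suc_eq)
  qed
qed simp

section \<open>Counting faces by the first facet containing them\<close>

context sweep
begin

definition new_faces :: "'a set \<Rightarrow> 'a set set" where
  "new_faces F = {K. K face_of F \<and> K \<noteq> {} \<and> (\<forall>F'. F' facet_of P \<and> w F' > w F \<longrightarrow> \<not> K \<subseteq> F')}"

definition face_polynomial :: "'a set set \<Rightarrow> complex poly" where
  "face_polynomial C = (\<Sum>K\<in>C. monom 1 (nat (aff_dim K)))"

lemma finite_facets: "finite {F. F facet_of P}"
  using finite_polytope_facets[OF polytope] .

text \<open>Each proper face is assigned to the facet with the largest \<open>w\<close> among those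
  containing it.\<close>

lemma proper_faces_eq: "{K. K face_of P \<and> K \<noteq> P \<and> K \<noteq> {}} = (\<Union>F\<in>{F. F facet_of P}. new_faces F)"
proof (intro equalityI subsetI)
  fix K assume "K \<in> {K. K face_of P \<and> K \<noteq> P \<and> K \<noteq> {}}"
  then have K: "K face_of P" "K \<noteq> P" "K \<noteq> {}" by auto
  define \<F> where "\<F> = {F. F facet_of P \<and> K \<subseteq> F}"
  obtain F0 where "F0 facet_of P" "K \<subseteq> F0"
    using face_of_polyhedron_subset_facet[OF polytope_imp_polyhedron[OF polytope] K(1,3,2)] .
  then have "\<F> \<noteq> {}"
    by (auto simp: \<F>_def)
  moreover have "finite \<F>"
    using finite_facets by (simp add: \<F>_def)
  ultimately have "Max (w ` \<F>) \<in> w ` \<F>"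
    by (intro Max_in) auto
  then obtain F where F: "F \<in> \<F>" "Max (w ` \<F>) = w F"
    by blast
  have "w F' \<le> w F" if "F' \<in> \<F>" for F'
    using that \<open>finite \<F>\<close> F(2) Max_ge[of "w ` \<F>" "w F'"] by simp
  moreover have "K face_of F"
    by (rule face_of_subset[OF K(1)]) (use F facet_of_imp_subset in \<open>auto simp: \<F>_def\<close>)
  ultimately have "K \<in> new_faces F"
    using K(3) by (auto simp: new_faces_def \<F>_def not_less[symmetric])
  then show "K \<in> (\<Union>F\<in>{F. F facet_of P}. new_faces F)"
    using F(1) by (auto simp: \<F>_def)
next
  fix K assume "K \<in> (\<Union>F\<in>{F. F facet_of P}. new_faces F)"
  then obtain F where F: "F facet_of P" "K face_of F" "K \<noteq> {}"
    by (auto simp: new_faces_def)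
  have "F \<subset> P"
    using facet_of_imp_subset[OF F(1)] F(1) facet_of_irrefl by auto
  then have "K \<noteq> P"
    using face_of_imp_subset[OF F(2)] by blast
  then show "K \<in> {K. K face_of P \<and> K \<noteq> P \<and> K \<noteq> {}}"
    using face_of_trans[OF F(2) facet_of_imp_face_of[OF F(1)]] F(3) by blast
qed

lemma new_faces_disjoint:
  assumes "F facet_of P" "F' facet_of P" "F \<noteq> F'"
  shows "new_faces F \<inter> new_faces F' = {}"
proof -
  have "K \<notin> new_faces F'" if "K \<in> new_faces F" for K
  proof
    assume K': "K \<in> new_faces F'"
    have "K \<subseteq> F" "K \<subseteq> F'"
      using that K' face_of_imp_subset by (auto simp: new_faces_def)
    then have "\<not> w F' > w F" "\<not> w F > w F'"
      using that K' assms by (auto simp: new_faces_def)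
    then have "w F = w F'" by linarith
    then show False
      using w_eq_iff assms by blast
  qed
  then show ?thesis by blast
qed

lemma face_polynomial_proper_faces:
  "face_polynomial {K. K face_of P \<and> K \<noteq> P \<and> K \<noteq> {}} = (\<Sum>F | F facet_of P. face_polynomial (new_faces F))"
  unfolding face_polynomial_def proper_faces_eq
proof (rule sum.UNION_disjoint)
  have "new_faces F \<subseteq> {K. K face_of P}" if "F facet_of P" for F
    using proper_faces_eq that by blast
  then show "\<forall>F\<in>{F. F facet_of P}. finite (new_faces F)"
    using finite_polytope_faces[OF polytope] by (auto intro: finite_subset)
qed (use finite_facets new_faces_disjoint in auto)

text \<open>\<open>\<psi> m\<close> lies in \<open>\<psi> [i \<mapsto> b]\<close> exactly when
  \<open>m\<close> fixes \<open>i\<close> to \<open>b\<close>. New faces are therefore the labels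
  avoiding early values, which \<open>sum_monom_maps\<close> counts.\<close>

lemma face_polynomial_new_faces:
  assumes F: "F facet_of P" and cube: "labelled_cube F k \<psi>"
  shows "face_polynomial (new_faces F) = (\<Prod>i<k. [:of_nat (card {b. \<psi> [i \<mapsto> b] \<notin> early F}), 1:])"
proof -
  interpret cube: labelled_cube F k \<psi> by (rule cube)
  define G where "G i = {b. \<psi> [i \<mapsto> b] \<notin> early F}" for i
  define N where "N = {m. dom m \<subseteq> {..<k} \<and> (\<forall>i b. m i = Some b \<longrightarrow> b \<in> G i)}"
  have early_facet: "\<exists>i b. i < k \<and> R = \<psi> [i \<mapsto> b]" if "R \<in> early F" for R
    using that cube.facet_iff by (simp add: early_def)
  have new_iff: "\<psi> m \<in> new_faces F \<longleftrightarrow> m \<in> N" if m: "dom m \<subseteq> {..<k}" for m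
  proof -
    have le: "\<psi> m \<subseteq> \<psi> [i \<mapsto> b] \<longleftrightarrow> m i = Some b" if "i < k" for i b
      using cube.order[OF m, of "[i \<mapsto> b]"] that by (auto simp: map_le_def)
    have "\<psi> m \<in> new_faces F \<longleftrightarrow> \<not> (\<exists>R\<in>early F. \<psi> m \<subseteq> R)"
      using subset_earlier_facet_iff[OF F cube.label_face[OF m]] cube.label_face[OF m]
      by (auto simp: new_faces_def)
    also have "\<dots> \<longleftrightarrow> (\<forall>i b. i < k \<longrightarrow> \<psi> [i \<mapsto> b] \<in> early F \<longrightarrow> m i \<noteq> Some b)"
      using early_facet le by metis
    also have "\<dots> \<longleftrightarrow> m \<in> N"
      using m by (auto simp: N_def G_def)
    finally show ?thesis .
  qed
  have "new_faces F = \<psi> ` N"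
  proof (intro equalityI subsetI)
    fix K assume K: "K \<in> new_faces F"
    then obtain m where m: "dom m \<subseteq> {..<k}" "K = \<psi> m"
      using cube.face_label by (auto simp: new_faces_def)
    then show "K \<in> \<psi> ` N"
      using K new_iff by blast
  qed (use new_iff in \<open>auto simp: N_def\<close>)
  moreover have "inj_on \<psi> N"
    by (rule inj_onI) (auto simp: N_def cube.label_eq_iff)
  ultimately have "face_polynomial (new_faces F) = (\<Sum>m\<in>N. monom 1 (nat (aff_dim (\<psi> m))))"
    by (simp add: face_polynomial_def sum.reindex)
  also have "\<dots> = (\<Sum>m\<in>N. monom 1 (card {..<k} - card (dom m)))"
    by (intro sum.cong) (auto simp: N_def cube.aff_dim_label)
  also have "\<dots> = (\<Prod>i<k. [:of_nat (card (G i)), 1:])"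
    using sum_monom_maps[of "{..<k}" G] by (simp add: N_def)
  finally show ?thesis
    by (simp add: G_def)
qed

lemma face_polynomial_first:
  assumes F: "F facet_of P" and cube: "labelled_cube F k \<psi>"
    and first: "\<And>F'. F' facet_of P \<Longrightarrow> w F' \<le> w F"
  shows "face_polynomial (new_faces F) = [:2, 1:] ^ k"
proof -
  have "early F = {}"
    using first neighbour(1)[OF F] by (fastforce simp: early_def)
  then show ?thesis
    by (simp add: face_polynomial_new_faces[OF F cube])
qed

text \<open>Every facet of \<open>F\<close> is early, so no coordinate may be fixed and only
  \<open>F\<close> itself is new.\<close>

lemma face_polynomial_last:
  assumes F: "F facet_of P" and cube: "labelled_cube F k \<psi>"
    and last: "\<And>F'. F' facet_of P \<Longrightarrow> w F \<le> w F'"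
  shows "face_polynomial (new_faces F) = [:0, 1:] ^ k"
proof -
  interpret cube: labelled_cube F k \<psi> by (rule cube)
  have "\<psi> [i \<mapsto> b] \<in> early F" if "i < k" for i b
  proof -
    have R: "\<psi> [i \<mapsto> b] facet_of F"
      using that cube.facet_iff by blast
    have "w F \<noteq> w (neighbour F (\<psi> [i \<mapsto> b]))"
      using w_eq_iff[OF F neighbour(1)[OF F R]] neighbour(2)[OF F R] by simp
    then show ?thesis
      using R last[OF neighbour(1)[OF F R]] by (simp add: early_def)
  qed
  then have "card {b. \<psi> [i \<mapsto> b] \<notin> early F} = 0" if "i < k" for i
    using that by simp
  then show ?thesis
    by (simp add: face_polynomial_new_faces[OF F cube])
qed

text \<open>An unbalanced pair of opposite facets contributes the required factor
  \<open>t + 1\<close>.\<close>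

lemma face_polynomial_middle:
  assumes F: "F facet_of P" and F1: "F1 facet_of P" "w F1 > w F" and F2: "F2 facet_of P" "w F2 < w F"
    and cube: "labelled_cube F k \<psi>"
  shows "\<exists>a b c. 0 < a \<and> a + b + c = k \<and>
    face_polynomial (new_faces F) = [:1, 1:] ^ a * [:0, 1:] ^ b * [:2, 1:] ^ c"
proof -
  let ?c = "\<lambda>i. card {b. \<psi> [i \<mapsto> b] \<notin> early F}"
  obtain i where i: "i < k" "(\<psi> [i \<mapsto> True] \<in> early F) \<noteq> (\<psi> [i \<mapsto> False] \<in> early F)"
    using unbalanced_pair_exists[OF F F1 F2 cube] by blast
  define b where "b \<longleftrightarrow> \<psi> [i \<mapsto> False] \<in> early F"
  have "{b. \<psi> [i \<mapsto> b] \<notin> early F} = {b}"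
  proof (rule set_eqI)
    fix b' show "b' \<in> {b. \<psi> [i \<mapsto> b] \<notin> early F} \<longleftrightarrow> b' \<in> {b}"
      using i(2) by (cases b') (auto simp: b_def)
  qed
  then have "?c i = 1"
    by simp
  moreover have "?c i \<le> 2" for i
    using card_mono[of "UNIV :: bool set" "{b. \<psi> [i \<mapsto> b] \<notin> early F}"] by simp
  ultimately show ?thesis
    using prod_linear_eq_powers[of k ?c] i(1) unfolding face_polynomial_new_faces[OF F cube] by metis
qed

end

text \<open>Each proper face lies in a facet and is therefore a cube; the chains below it depend on
  its dimension alone.\<close>

lemma chain_sum_proper_faces:
  fixes P :: "'a::euclidean_space set"
  assumes P: "polytope P" and cube: "\<And>F. F facet_of P \<Longrightarrow> combinatorial_cube F"
  shows "chain_sum y {K. K face_of P \<and> K \<noteq> P \<and> K \<noteq> {}} = 1 + y * (\<Sum>K | K face_of P \<and> K \<noteq> P \<and> K \<noteq> {}. cube_chains y (nat (aff_dim K)))"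
proof -
  let ?C = "{K. K face_of P \<and> K \<noteq> P \<and> K \<noteq> {}}"
  have "chain_sum y {K' \<in> ?C. K' \<subset> K} = cube_chains y (nat (aff_dim K))" if "K \<in> ?C" for K
  proof -
    have K: "K face_of P" "K \<noteq> P" "K \<noteq> {}" using that by auto
    obtain F where F: "F facet_of P" "K \<subseteq> F"
      using face_of_polyhedron_subset_facet[OF polytope_imp_polyhedron[OF P] K(1,3,2)] .
    obtain k \<psi> where "labelled_cube F k \<psi>"
      using combinatorial_cube_imp_labelled[OF cube[OF F(1)]] .
    then interpret cube: labelled_cube F k \<psi> .
    have "K face_of F"
      using face_of_subset[OF K(1) F(2) facet_of_imp_subset[OF F(1)]] .
    then obtain m where m: "dom m \<subseteq> {..<k}" "K = \<psi> m"
      using K(3) by (rule cube.face_label)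
    have "K' face_of P \<and> K' \<noteq> P \<and> K' \<noteq> {} \<longleftrightarrow> K' face_of F \<and> K' \<noteq> {}" if "K' \<subset> K" for K'
      using that F(2) face_of_face[OF facet_of_imp_face_of[OF F(1)], of K'] face_of_imp_subset[OF K(1)] by auto
    then have "{K' \<in> ?C. K' \<subset> K} = {K' \<in> {K. K face_of F \<and> K \<noteq> {}}. K' \<subset> K}"
      by auto
    then have "{K' \<in> ?C. K' \<subset> K} = {K' \<in> \<psi> ` {m. dom m \<subseteq> {..<k}}. K' \<subset> \<psi> m}"
      unfolding cube.image m(2) .
    then show ?thesis
      using chain_sum_cube[of "{..<k}" \<psi> m y] cube.order m cube.aff_dim_label[OF m(1)] by simp
  qed
  moreover have "finite ?C"
    using finite_polytope_faces[OF P] by (rule rev_finite_subset) auto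
  ultimately show ?thesis
    by (simp add: chain_sum_eq)
qed

text \<open>The first, last and middle facets of the sweep supply exactly the summands required by
  \<open>chain_functional_nonzero\<close>.\<close>

lemma chain_sum_cubical_nonzero:
  fixes P :: "'a::euclidean_space set"
  assumes P: "polytope P" "P \<noteq> {}" and cube: "\<And>F. F facet_of P \<Longrightarrow> combinatorial_cube F"
    and z: "Im z > 0"
  shows "chain_sum (z / (1 - z)) {K. K face_of P \<and> K \<noteq> P \<and> K \<noteq> {}} \<noteq> 0"
proof (cases "aff_dim P > 0")
  case False
  then have "aff_dim P = 0"
    using P(2) aff_dim_negative_iff[of P] by linarith
  then obtain a where "P = {a}"
    using aff_dim_eq_0 by blast
  then have no_faces: "{K. K face_of P \<and> K \<noteq> P \<and> K \<noteq> {}} = {}"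
    using face_of_imp_subset by blast
  show ?thesis
    unfolding no_faces using chain_sum_eq[of "{} :: 'a set set"] by simp
next
  case True
  obtain \<alpha> \<beta> p u where "sweep P \<alpha> \<beta> p u"
    using sweep_exists[OF P] .
  then interpret sweep P \<alpha> \<beta> p u .
  \<comment> \<open>All facets are cubes of this common dimension.\<close>
  define n where "n = nat (aff_dim P - 1)"
  have label: "\<exists>\<psi>. labelled_cube F n \<psi>" if F: "F facet_of P" for F
  proof -
    obtain k \<psi> where k: "labelled_cube F k \<psi>"
      using combinatorial_cube_imp_labelled[OF cube[OF F]] .
    then have "int k = aff_dim P - 1"
      using labelled_cube.aff_dim_eq[OF k] F by (simp add: facet_of_def)
    then have "k = n"
      by (simp add: n_def)
    then show ?thesis using k by blast
  qed
  let ?\<F> = "{F. F facet_of P}"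
  obtain G G' where G: "G facet_of P" "G' facet_of P" "G \<noteq> G'"
    using exists_two_facets[OF P(1) True] .
  then have ne: "w ` ?\<F> \<noteq> {}" "finite (w ` ?\<F>)"
    using finite_facets by auto
  obtain F1 where F1: "F1 facet_of P" "Max (w ` ?\<F>) = w F1"
    using Max_in[OF ne(2,1)] by auto
  obtain F2 where F2: "F2 facet_of P" "Min (w ` ?\<F>) = w F2"
    using Min_in[OF ne(2,1)] by auto
  have first: "w F \<le> w F1" if "F facet_of P" for F
    using Max_ge[OF ne(2), of "w F"] that F1(2) by simp
  have last: "w F2 \<le> w F" if "F facet_of P" for F
    using Min_le[OF ne(2), of "w F"] that F2(2) by simp
  have "F1 \<noteq> F2"
    using first[OF G(1)] first[OF G(2)] last[OF G(1)] last[OF G(2)] w_eq_iff[OF G(1,2)] G(3) by auto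
  let ?S = "?\<F> - {F1} - {F2}"
  have "\<exists>a b c. 0 < a \<and> a + b + c = n \<and>
      face_polynomial (new_faces F) = [:1, 1:] ^ a * [:0, 1:] ^ b * [:2, 1:] ^ c" if "F \<in> ?S" for F
  proof -
    have F: "F facet_of P" "F \<noteq> F1" "F \<noteq> F2" using that by auto
    have "w F < w F1" "w F2 < w F"
      using first[OF F(1)] last[OF F(1)] w_eq_iff[OF F(1) F1(1)] w_eq_iff[OF F(1) F2(1)] F(2,3) by auto
    moreover obtain \<psi> where "labelled_cube F n \<psi>"
      using label[OF F(1)] by blast
    ultimately show ?thesis
      using face_polynomial_middle[OF F(1) F1(1) _ F2(1)] by blast
  qed
  then obtain a b c where abc: "\<And>F. F \<in> ?S \<Longrightarrow> 0 < a F \<and> a F + b F + c F = n"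
    and poly: "\<And>F. F \<in> ?S \<Longrightarrow> face_polynomial (new_faces F) = [:1, 1:] ^ a F * [:0, 1:] ^ b F * [:2, 1:] ^ c F"
    by metis
  let ?C = "{K. K face_of P \<and> K \<noteq> P \<and> K \<noteq> {}}"
  have "face_polynomial ?C = face_polynomial (new_faces F1) + (face_polynomial (new_faces F2) + (\<Sum>F\<in>?S. face_polynomial (new_faces F)))"
    unfolding face_polynomial_proper_faces using finite_facets F1(1) F2(1) \<open>F1 \<noteq> F2\<close>
    by (subst sum.remove[of _ F1]) (auto simp: sum.remove[of _ F2])
  also have "(\<Sum>F\<in>?S. face_polynomial (new_faces F)) = (\<Sum>F\<in>?S. [:1, 1:] ^ a F * [:0, 1:] ^ b F * [:2, 1:] ^ c F)"
    using poly by (intro sum.cong) auto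
  also have "face_polynomial (new_faces F1) = [:2, 1:] ^ n"
    using label[OF F1(1)] face_polynomial_first[OF F1(1) _ first] by blast
  also have "face_polynomial (new_faces F2) = [:0, 1:] ^ n"
    using label[OF F2(1)] face_polynomial_last[OF F2(1) _ last] by blast
  finally have "face_polynomial ?C = [:2, 1:] ^ n + [:0, 1:] ^ n + (\<Sum>F\<in>?S. [:1, 1:] ^ a F * [:0, 1:] ^ b F * [:2, 1:] ^ c F)"
    by (simp only: add.assoc)
  from chain_functional_nonzero[OF z abc this]
  have "1 + z / (1 - z) * chain_functional (z / (1 - z)) (face_polynomial ?C) \<noteq> 0" .
  moreover have "chain_functional (z / (1 - z)) (face_polynomial ?C) = (\<Sum>K\<in>?C. cube_chains (z / (1 - z)) (nat (aff_dim K)))"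
    by (simp add: face_polynomial_def chain_functional_sum chain_functional_monom)
  ultimately show ?thesis
    using chain_sum_proper_faces[OF P(1) cube] by simp
qed

lemma chain_sum_cnj: "chain_sum (cnj y) C = cnj (chain_sum y C)"
  by (simp add: chain_sum_def)

theorem corollary4p10:
  fixes P :: "'a::euclidean_space set"
  assumes "neighborly_cubical_polytope P"
  shows "real_rooted (h_polynomial (barycentric_subdivision (boundary_complex P)))"
proof -
  have P: "polytope P" "P \<noteq> {}" and cube: "\<And>F. F facet_of P \<Longrightarrow> combinatorial_cube F"
    using assms by (auto simp: neighborly_cubical_polytope_def cubical_polytope_def)
  let ?C = "{K. K face_of P \<and> K \<noteq> P \<and> K \<noteq> {}}"
  have C: "boundary_complex P - {{}} = ?C"
    by (auto simp: boundary_complex_def)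
  have fin: "finite (boundary_complex P)"
    using finite_polytope_faces[OF P(1)] by (rule rev_finite_subset) (auto simp: boundary_complex_def)
  have "z \<in> \<real>" if root: "poly (map_poly of_real (h_polynomial (barycentric_subdivision (boundary_complex P)))) z = 0"
    for z :: complex
  proof (rule ccontr)
    assume "z \<notin> \<real>"
    then have Im: "Im z \<noteq> 0"
      by (simp add: complex_is_Real_iff)
    then have "z \<noteq> 1" by auto
    then have 0: "chain_sum (z / (1 - z)) ?C = 0"
      using root poly_h_polynomial_barycentric_subdivision[OF fin \<open>z \<noteq> 1\<close>] by (simp add: C)
    show False
    proof (cases "Im z > 0")
      case True
      then show False
        using chain_sum_cubical_nonzero[OF P cube] 0 by blast
    next
      case False
      \<comment> \<open>Chain sums have real coefficients, so a zero in the lower half-plane has its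
        conjugate as a zero in the upper one.\<close>
      then have "Im (cnj z) > 0"
        using Im by simp
      then have "chain_sum (cnj z / (1 - cnj z)) ?C \<noteq> 0"
        using chain_sum_cubical_nonzero[OF P cube] by blast
      moreover have "cnj z / (1 - cnj z) = cnj (z / (1 - z))"
        by simp
      ultimately show False
        using 0 by (simp only: chain_sum_cnj) simp
    qed
  qed
  then show ?thesis
    by (simp add: real_rooted_def)
qed

end
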